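(* Isomorphism of computable subgroups of $(\mathbb{Q},+)$ is complete for $\Sigma^0_3$ equivalence relations. That is, the relation $\{(i,j): G_i\cong G_j\}$ is a $\Sigma^0_3$ equivalence relation on $\mathbb{N}$, and for every $\Sigma^0_3$ equivalence relation $E$ on $\mathbb{N}$ there is a computable $f:\mathbb{N}\to\mathbb{N}$ such that for all $x,y\in\mathbb{N}$: $$(x,y)\in E\iff G_{f(x)}\cong G_{f(y)}.$$
   Context: A computable subgroup of $(\mathbb{Q},+)$ is a 4-tuple of (total) computable functions $(e,\oplus,\ominus,I)$, where natural numbers encode group elements (not necessarily uniquely), $I:\mathbb{N}\to\mathbb{Q}$ is an interpretation function, $\oplus$ encodes the group operation with $I(\oplus(a,b))=I(a)+I(b)$, $\ominus$ encodes inverses, and $e$ is the characteristic function of the set of codes of the identity; the represented group is $I(\mathbb{N})\subseteq\mathbb{Q}$. Computable subgroups are indexed as follows. Let $W_i$ be the $i$th recursively enumerable set, viewed as a set of pairs $(x,y)$ of natural numbers, closed downward in the second component. Let $p_0=1$ and let $p_x$ ($x\ge1$) be the $x$th prime. $G_i$ is the subgroup of $\mathbb{Q}$ generated by $1$ together with all $1/p_x^y$ with $(x,y)\in W_i$; uniformly in $i$, there is a 4-tuple of total computable functions $(e,\oplus,\ominus,I)$ which is a computable subgroup of $(\mathbb{Q},+)$ with represented group $I(\mathbb{N})=G_i$, and every computable subgroup of $(\mathbb{Q},+)$ containing $1$ is some $G_i$. $\cong$ denotes isomorphism of groups. A $\Sigma^0_3$ equivalence relation is an equivalence relation on $\mathbb{N}$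 that is $\Sigma^0_3$ as a set of pairs. Completeness is with respect to computable component-wise reducibility: $R\le S$ iff there is a computable $f$ with $(x,y)\in R\iff(f(x),f(y))\in S$ for all $x,y$. *)

theory Defs
  imports
    Complex_Main
    "HOL-Library.Nat_Bijection"
    "HOL-Library.Infinite_Set"
    "HOL-Computational_Algebra.Primes"
    "HOL-Algebra.Elementary_Groups"
begin

section \<open>Partial recursive functions\<close>

text \<open>
  Programs denote partial functions in one argument; tuples are coded by \<^const>\<open>prod_encode\<close>.
  The constructors are the usual ones of the mu-recursive functions, with \<open>Fst\<close>, \<open>Snd\<close> and
  \<open>Pr\<close> (pairing) in place of projections and composition with several functions.
\<close>

datatype recf =
    Zero
  | Succ
  | Fst
  | Snd
  | Pr recf recf
  | Cn recf recf
  | Rec recf recf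
  | Mn recf

text \<open>
  The least zero of \<open>n \<mapsto> f \<langle>x, n\<rangle>\<close>, undefined unless \<open>f\<close> is defined at all smaller arguments.
\<close>

definition minimise :: "(nat \<rightharpoonup> nat) \<Rightarrow> (nat \<rightharpoonup> nat)" where
  "minimise f x =
    (if \<exists>n. f (prod_encode (x, n)) = Some 0 \<and> (\<forall>m<n. f (prod_encode (x, m)) \<noteq> None)
     then Some (LEAST n. f (prod_encode (x, n)) = Some 0)
     else None)"

primrec eval :: "recf \<Rightarrow> (nat \<rightharpoonup> nat)" where
  "eval Zero = (\<lambda>x. Some 0)"
| "eval Succ = (\<lambda>x. Some (Suc x))"
| "eval Fst = (\<lambda>x. Some (fst (prod_decode x)))"
| "eval Snd = (\<lambda>x. Some (snd (prod_decode x)))"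
| "eval (Pr a b) =
    (\<lambda>x. Option.bind (eval a x) (\<lambda>u. Option.bind (eval b x) (\<lambda>v. Some (prod_encode (u, v)))))"
| "eval (Cn a b) = (\<lambda>x. Option.bind (eval b x) (eval a))"
| "eval (Rec a b) =
    (\<lambda>x. case prod_decode x of (z, n) \<Rightarrow>
       rec_nat (eval a z)
         (\<lambda>m r. Option.bind r (\<lambda>u. eval b (prod_encode (z, prod_encode (m, u))))) n)"
| "eval (Mn a) = minimise (eval a)"

text \<open>A Goedel numbering in which every natural number is the code of exactly one program.\<close>

primrec goedel :: "recf \<Rightarrow> nat" where
  "goedel Zero = 0"
| "goedel Succ = 1"
| "goedel Fst = 2"
| "goedel Snd = 3"
| "goedel (Pr a b) = 4 * prod_encode (goedel a, goedel b) + 4"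
| "goedel (Cn a b) = 4 * prod_encode (goedel a, goedel b) + 5"
| "goedel (Rec a b) = 4 * prod_encode (goedel a, goedel b) + 6"
| "goedel (Mn a) = 4 * goedel a + 7"

lemma bij_goedel: "bij goedel"
proof (rule bijI)
  have "goedel c = goedel d \<Longrightarrow> c = d" for c d
  proof (induction c arbitrary: d)
    case Zero
    then show ?case by (cases d) auto
  next
    case Succ
    then show ?case by (cases d) auto
  next
    case Fst
    then show ?case by (cases d) auto
  next
    case Snd
    then show ?case by (cases d) auto
  next
    case (Pr a b)
    then show ?case by (cases d; simp; presburger)
  next
    case (Cn a b)
    then show ?case by (cases d; simp; presburger)
  next
    case (Rec a b)
    then show ?case by (cases d; simp; presburger)
  next
    case (Mn a)
    then show ?case by (cases d; simp; presburger)
  qed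
  then show "inj goedel" by (auto intro: injI)
next
  have "\<exists>c. goedel c = n" for n
  proof (induction n rule: less_induct)
    case (less n)
    show ?case
    proof (cases "n < 4")
      case True
      then have "n = 0 \<or> n = 1 \<or> n = 2 \<or> n = 3" by auto
      then show ?thesis using goedel.simps(1-4) by metis
    next
      case False
      define k where "k = (n - 4) div 4"
      define u v where "u = fst (prod_decode k)" and "v = snd (prod_decode k)"
      have k: "k = prod_encode (u, v)" by (simp add: u_def v_def)
      have "k < n" using False by (simp add: k_def)
      moreover have "u \<le> k" "v \<le> k"
        using k le_prod_encode_1 le_prod_encode_2 by auto
      ultimately obtain a b c where "goedel a = u" "goedel b = v" "goedel c = k"
        using less.IH by (meson le_less_trans)
      moreover have "n = 4 * k + 4 \<or> n = 4 * k + 5 \<or> n = 4 * k + 6 \<or> n = 4 * k + 7"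
        using False unfolding k_def by presburger
      ultimately have "n \<in> {goedel (Pr a b), goedel (Cn a b), goedel (Rec a b), goedel (Mn c)}"
        using k by auto
      then show ?thesis by blast
    qed
  qed
  then show "surj goedel" by (metis surjI)
qed

definition computable :: "(nat \<Rightarrow> nat) \<Rightarrow> bool" where
  "computable f \<longleftrightarrow> (\<exists>c. \<forall>x. eval c x = Some (f x))"

definition re_set :: "nat \<Rightarrow> nat set" where
  "re_set i = dom (eval (the_inv goedel i))"


section \<open>Relations on the natural numbers\<close>

definition decidable :: "nat set \<Rightarrow> bool" where
  "decidable A \<longleftrightarrow> computable (\<lambda>n. if n \<in> A then 1 else 0)"

definition Sigma03 :: "nat set \<Rightarrow> bool" where
  "Sigma03 A \<longleftrightarrow>
    (\<exists>D. decidable D \<and>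
      (\<forall>n. n \<in> A \<longleftrightarrow>
        (\<exists>a. \<forall>b. \<exists>c. prod_encode (n, prod_encode (a, prod_encode (b, c))) \<in> D)))"

definition Sigma03_equiv :: "(nat \<times> nat) set \<Rightarrow> bool" where
  "Sigma03_equiv E \<longleftrightarrow> equiv UNIV E \<and> Sigma03 (prod_encode ` E)"

definition reducible :: "(nat \<times> nat) set \<Rightarrow> (nat \<times> nat) set \<Rightarrow> bool" where
  "reducible R S \<longleftrightarrow>
    (\<exists>f. computable f \<and> (\<forall>x y. (x, y) \<in> R \<longleftrightarrow> (f x, f y) \<in> S))"

definition Sigma03_equiv_complete :: "(nat \<times> nat) set \<Rightarrow> bool" where
  "Sigma03_equiv_complete S \<longleftrightarrow>
    Sigma03_equiv S \<and> (\<forall>E. Sigma03_equiv E \<longrightarrow> reducible E S)"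


section \<open>Computable subgroups of the rationals\<close>

definition rat_group :: "rat monoid" where
  "rat_group = \<lparr>carrier = UNIV, monoid.mult = (+), one = 0\<rparr>"

lemma group_rat_group: "group rat_group"
  by (rule groupI) (auto simp: rat_group_def intro: exI[of _ "- x" for x])

text \<open>The primes in increasing order, preceded by 1, so that \<open>nth_prime 1 = 2\<close>.\<close>

primrec nth_prime :: "nat \<Rightarrow> nat" where
  "nth_prime 0 = 1"
| "nth_prime (Suc n) = enumerate {p. prime p} n"

text \<open>The \<open>i\<close>th r.e. set of pairs, closed downward in the second component.\<close>

definition W :: "nat \<Rightarrow> (nat \<times> nat) set" where
  "W i = {(x, y). \<exists>y'\<ge>y. prod_encode (x, y') \<in> re_set i}"

definition G :: "nat \<Rightarrow> rat monoid" where
  "G i = subgroup_generated rat_group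
    (insert 1 {1 / of_nat (nth_prime x ^ y) | x y. (x, y) \<in> W i})"

end

theory Submission
  imports Defs
begin

text \<open>
  By comparing divisibility by prime powers, \<open>G i \<cong> G j\<close> iff the heights of the primes in \<open>G i\<close> and
  \<open>G j\<close> agree up to finitely many finite discrepancies. With a universal machine for the
  enumeration of the sets \<open>W i\<close> this is a \<open>\<Sigma>\<^sup>0\<^sub>3\<close> condition.

  For hardness, write \<open>(u, w) \<in> E\<close> as: some witness \<open>a\<close> fires infinitely often. For each position
  \<open>\<pi> = \<langle>n, \<langle>x, y\<rangle>\<rangle>\<close>, i.e. for a prime reserved for the pair \<open>x, y\<close>, all groups have one of the heights
  \<open>v\<close> and \<open>v + 1\<close> at every stage; initially only group \<open>x\<close> is raised to \<open>v + 1\<close>. Whenever one of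
  the first \<open>\<pi>\<close> witnesses fires, say for \<open>(u, w)\<close>, and one of \<open>u, w\<close> is raised, the other is raised as
  well. Once \<open>y\<close> is raised, \<open>v\<close> is incremented and only \<open>x\<close> is raised again. If \<open>(u, w) \<in> E\<close>, then the
  heights for \<open>u\<close> and \<open>w\<close> agree in the limit at all but finitely many positions and differ at most
  by 1 at the others. If \<open>(x, y) \<notin> E\<close>, then \<open>v\<close> is bounded and \<open>x, y\<close> end up with different heights
  at every position reserved for them.
\<close>

section \<open>Computable functions and decidable sets\<close>

abbreviation pfst :: "nat \<Rightarrow> nat" where "pfst n \<equiv> fst (prod_decode n)"
abbreviation psnd :: "nat \<Rightarrow> nat" where "psnd n \<equiv> snd (prod_decode n)"

lemma computableI: "(\<And>x. eval c x = Some (f x)) \<Longrightarrow> computable f"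
  unfolding computable_def by blast

lemma computable_ident: "computable (\<lambda>x. x)"
  by (rule computableI[of "Pr Fst Snd"]) simp

lemma computable_comp:
  assumes "computable f" "computable g"
  shows "computable (\<lambda>x. f (g x))"
proof -
  from assms obtain a b where "\<And>x. eval a x = Some (f x)" "\<And>x. eval b x = Some (g x)"
    unfolding computable_def by blast
  then show ?thesis by (intro computableI[of "Cn a b"]) simp
qed

lemma computable_Suc: "computable f \<Longrightarrow> computable (\<lambda>x. Suc (f x))"
  by (rule computable_comp[of Suc]) (auto intro: computableI[of Succ])

lemma computable_pfst: "computable f \<Longrightarrow> computable (\<lambda>x. pfst (f x))"
  by (rule computable_comp[of pfst]) (auto intro: computableI[of Fst])

lemma computable_psnd: "computable f \<Longrightarrow> computable (\<lambda>x. psnd (f x))"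
  by (rule computable_comp[of psnd]) (auto intro: computableI[of Snd])

lemma computable_pair:
  assumes "computable f" "computable g"
  shows "computable (\<lambda>x. prod_encode (f x, g x))"
proof -
  from assms obtain a b where "\<And>x. eval a x = Some (f x)" "\<And>x. eval b x = Some (g x)"
    unfolding computable_def by blast
  then show ?thesis by (intro computableI[of "Pr a b"]) simp
qed

lemma computable_const: "computable (\<lambda>x. k)"
  by (induction k) (auto intro: computableI[of Zero] computable_Suc)

text \<open>The nested pairs in the hypothesis on \<open>b\<close> are the arguments that
  \<open>Rec\<close> passes to its step program. The arithmetic functions below thus only need a
  recursion equation.\<close>

lemma computable_rec_nat:
  assumes "computable a" "computable (\<lambda>t. b (pfst t) (pfst (psnd t)) (psnd (psnd t)))"
    and "computable g"
  shows "computable (\<lambda>x. rec_nat (a x) (b x) (g x))"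
proof -
  from assms obtain p q where p: "\<And>x. eval p x = Some (a x)"
    and q: "\<And>t. eval q t = Some (b (pfst t) (pfst (psnd t)) (psnd (psnd t)))"
    unfolding computable_def by blast
  have "rec_nat (eval p z) (\<lambda>m r. Option.bind r (\<lambda>u. eval q (prod_encode (z, prod_encode (m, u))))) n
      = Some (rec_nat (a z) (b z) n)" for z n
    by (induction n) (simp_all add: p q)
  then have "computable (\<lambda>t. rec_nat (a (pfst t)) (b (pfst t)) (psnd t))"
    by (intro computableI[of "Rec p q"]) (simp add: split_beta)
  from computable_comp[OF this computable_pair[OF computable_ident assms(3)]] show ?thesis
    by simp
qed

lemma computable_pred: "computable f \<Longrightarrow> computable (\<lambda>x. f x - 1)"
proof (rule computable_comp[of "\<lambda>n. n - 1"])
  have "n - 1 = rec_nat 0 (\<lambda>m r. m) n" for n :: nat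
    by (cases n) auto
  then show "computable (\<lambda>n. n - 1)"
    by (simp only:) (intro computable_rec_nat computable_const computable_ident
        computable_pfst computable_psnd)
qed

lemma computable_diff:
  assumes "computable f" "computable g"
  shows "computable (\<lambda>x. f x - g x)"
proof -
  have "m - n = rec_nat m (\<lambda>_ r. r - 1) n" for m n :: nat
    by (induction n) auto
  then have "(\<lambda>x. f x - g x) = (\<lambda>x. rec_nat (f x) (\<lambda>_ r. r - 1) (g x))"
    by (intro ext)
  then show ?thesis
    by (rule ssubst) (intro computable_rec_nat assms computable_ident
        computable_pred computable_psnd)
qed

lemma computable_add:
  assumes "computable f" "computable g"
  shows "computable (\<lambda>x. f x + g x)"
proof -
  have "m + n = rec_nat m (\<lambda>_ r. Suc r) n" for m n :: nat
    by (induction n) auto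
  then show ?thesis
    by (simp only:) (intro computable_rec_nat assms computable_ident
        computable_Suc computable_psnd)
qed

lemma computable_mult:
  assumes "computable f" "computable g"
  shows "computable (\<lambda>x. f x * g x)"
proof -
  have "m * n = rec_nat 0 (\<lambda>_ r. r + m) n" for m n :: nat
    by (induction n) auto
  then show ?thesis
    by (simp only:) (intro computable_rec_nat assms computable_ident computable_const
        computable_add computable_comp[OF assms(1)] computable_pfst computable_psnd)
qed

lemma computable_power:
  assumes "computable f" "computable g"
  shows "computable (\<lambda>x. f x ^ g x)"
proof -
  have "m ^ n = rec_nat 1 (\<lambda>_ r. r * m) n" for m n :: nat
    by (induction n) auto
  then show ?thesis
    by (simp only:) (intro computable_rec_nat assms computable_ident computable_const
        computable_mult computable_comp[OF assms(1)] computable_pfst computable_psnd)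
qed

lemma computable_if:
  assumes "decidable {x. P x}" "computable f" "computable g"
  shows "computable (\<lambda>x. if P x then f x else g x)"
proof -
  have P: "computable (\<lambda>x. if P x then 1 else 0)"
    using assms(1) by (simp add: decidable_def)
  have f: "computable (\<lambda>t. f (pfst t))"
    by (rule computable_comp[OF assms(2) computable_pfst[OF computable_ident]])
  \<comment> \<open>A case distinction is a recursion of length 0 or 1 whose step ignores the
    previous value.\<close>
  have eq: "(\<lambda>x. if P x then f x else g x) =
      (\<lambda>x. rec_nat (g x) (\<lambda>_ _. f x) (if P x then 1 else 0))"
    by auto
  show ?thesis unfolding eq by (rule computable_rec_nat[OF assms(3) f P])
qed

section \<open>Decidable sets and bounded quantifiers\<close>

lemma decidable_comp: "decidable A \<Longrightarrow> computable f \<Longrightarrow> decidable {x. f x \<in> A}"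
  unfolding decidable_def using computable_comp by simp

lemma decidable_neq_0:
  assumes "computable f"
  shows "decidable {x. f x \<noteq> 0}"
proof -
  have "(if f x \<noteq> 0 then 1 else 0) = rec_nat (0::nat) (\<lambda>_ _. 1) (f x)" for x
    by (cases "f x") auto
  then show ?thesis
    unfolding decidable_def mem_Collect_eq
    by (simp only:) (intro computable_rec_nat assms computable_const)
qed

lemma decidable_not:
  assumes "decidable {x. P x}"
  shows "decidable {x. \<not> P x}"
proof -
  have eq: "(\<lambda>x. if x \<in> {x. \<not> P x} then 1 else 0) = (\<lambda>x. if P x then 0 else 1)"
    by auto
  show ?thesis unfolding decidable_def eq
    by (intro computable_if assms computable_const)
qed

lemma decidable_conj:
  assumes "decidable {x. P x}" "decidable {x. Q x}"
  shows "decidable {x. P x \<and> Q x}"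
proof -
  have eq: "(\<lambda>x. if x \<in> {x. P x \<and> Q x} then 1 else 0) =
      (\<lambda>x. if P x then if Q x then 1 else 0 else 0)"
    by auto
  show ?thesis unfolding decidable_def eq
    by (intro computable_if assms computable_const)
qed

lemma decidable_disj:
  assumes "decidable {x. P x}" "decidable {x. Q x}"
  shows "decidable {x. P x \<or> Q x}"
  using decidable_not[OF decidable_conj[OF assms[THEN decidable_not]]] by simp

lemma decidable_imp:
  assumes "decidable {x. P x}" "decidable {x. Q x}"
  shows "decidable {x. P x \<longrightarrow> Q x}"
  using decidable_disj[OF assms(1)[THEN decidable_not] assms(2)] by simp

text \<open>Truncated subtraction decides the order: \<open>g x - f x\<close> is nonzero exactly
  when \<open>f x < g x\<close>.\<close>

lemma decidable_less:
  assumes "computable f" "computable g"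
  shows "decidable {x. f x < g x}"
  using decidable_neq_0[OF computable_diff[OF assms(2,1)]] by (simp add: not_le)

lemma decidable_le:
  assumes "computable f" "computable g"
  shows "decidable {x. f x \<le> g x}"
  using decidable_not[OF decidable_less[OF assms(2,1)]] by (simp add: not_less)

lemma decidable_eq:
  assumes "computable f" "computable g"
  shows "decidable {x. f x = g x}"
  using decidable_conj[OF decidable_le[OF assms] decidable_le[OF assms(2,1)]]
  by (simp add: eq_iff)

lemma decidable_bex:
  assumes "decidable {t. P (pfst t) (psnd t)}" "computable g"
  shows "decidable {x. \<exists>m<g x. P x m}"
proof -
  have "(\<exists>m<n. P x m) \<longleftrightarrow> rec_nat 0 (\<lambda>m r. if P x m then 1 else r) n \<noteq> (0::nat)" for x n
    by (induction n) (auto simp: less_Suc_eq)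
  moreover have "decidable {t. P (pfst t) (pfst (psnd t))}"
    using decidable_comp[OF assms(1), of "\<lambda>t. prod_encode (pfst t, pfst (psnd t))"]
    by (simp add: computable_pair computable_pfst computable_psnd computable_ident)
  ultimately show ?thesis
    by (simp only:) (intro decidable_neq_0 computable_rec_nat computable_if computable_const
        computable_ident computable_psnd assms(2))
qed

lemma decidable_ball:
  assumes "decidable {t. P (pfst t) (psnd t)}" "computable g"
  shows "decidable {x. \<forall>m<g x. P x m}"
  using decidable_not[OF decidable_bex[OF assms(1)[THEN decidable_not] assms(2)]] by simp

lemma computable_mod:
  assumes "computable f" "computable g"
  shows "computable (\<lambda>x. f x mod g x)"
proof -
  \<comment> \<open>The remainder counts cyclically. For \<open>n = 0\<close> it is never reset, in
    accordance with \<open>m mod 0 = m\<close>.\<close>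
  have "m mod n = rec_nat 0 (\<lambda>_ r. if Suc r = n then 0 else Suc r) m" for m n :: nat
    by (induction m) (auto simp: mod_Suc)
  then show ?thesis
    by (simp only:) (intro computable_rec_nat computable_if decidable_eq assms computable_ident
        computable_const computable_Suc computable_comp[OF assms(2)] computable_pfst computable_psnd)
qed

lemma computable_div:
  assumes "computable f" "computable g"
  shows "computable (\<lambda>x. f x div g x)"
proof -
  \<comment> \<open>The quotient grows at each positive multiple of \<open>n\<close>. For
    \<open>n = 0\<close> it never grows, in accordance with \<open>m div 0 = 0\<close>.\<close>
  have "m div n = rec_nat 0 (\<lambda>i r. if Suc i mod n = 0 then Suc r else r) m" for m n :: nat
    by (induction m) (auto simp: div_Suc)
  then show ?thesis
    by (simp only:) (intro computable_rec_nat computable_if decidable_eq assms computable_ident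
        computable_const computable_Suc computable_mod computable_comp[OF assms(2)]
        computable_pfst computable_psnd)
qed

lemma computable_funpow:
  assumes "computable h" "computable f" "computable g"
  shows "computable (\<lambda>x. (h ^^ g x) (f x))"
proof -
  have "(h ^^ n) z = rec_nat z (\<lambda>_ r. h r) n" for n z
    by (induction n) auto
  then show ?thesis
    by (simp only:) (intro computable_rec_nat assms computable_comp[OF assms(1)]
        computable_psnd computable_ident)
qed

lemmas computable_intros =
  computable_ident computable_const computable_Suc computable_pfst computable_psnd
  computable_pair computable_diff computable_add computable_mult computable_power computable_if
  computable_mod computable_div decidable_not decidable_conj decidable_disj decidable_imp
  decidable_eq decidable_less decidable_le decidable_bex decidable_ball

section \<open>A universal machine\<close>

text \<open>
  Machine states are either \<open>ev_state c x k\<close>, about to run the program with code \<open>c\<close> on \<open>x\<close>, or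
  \<open>ret_state v k\<close>, returning \<open>v\<close> to the stack \<open>k\<close>. The stack is 0 or \<open>push t d k\<close>, whose top frame
  has a tag \<open>t\<close> and data \<open>d\<close>: pairing awaiting its first (0) or second (1) component, composition (2),
  recursion (3, with the number of finished rounds) and minimisation (4, with the current candidate).
\<close>

definition ev_state :: "nat \<Rightarrow> nat \<Rightarrow> nat \<Rightarrow> nat" where
  "ev_state c x k = prod_encode (0, prod_encode (c, prod_encode (x, k)))"

definition ret_state :: "nat \<Rightarrow> nat \<Rightarrow> nat" where
  "ret_state v k = prod_encode (1, prod_encode (v, k))"

definition push :: "nat \<Rightarrow> nat \<Rightarrow> nat \<Rightarrow> nat" where
  "push t d k = Suc (prod_encode (prod_encode (t, d), k))"

text \<open>The residues modulo 4 are those of the clauses of \<^const>\<open>goedel\<close>.\<close>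

definition step_ev :: "nat \<Rightarrow> nat \<Rightarrow> nat \<Rightarrow> nat" where
  "step_ev c x k =
    (if c = 0 then ret_state 0 k
     else if c = 1 then ret_state (Suc x) k
     else if c = 2 then ret_state (pfst x) k
     else if c = 3 then ret_state (psnd x) k
     else if c mod 4 = 0 then
       ev_state (pfst ((c - 4) div 4)) x (push 0 (prod_encode (psnd ((c - 4) div 4), x)) k)
     else if c mod 4 = 1 then
       ev_state (psnd ((c - 4) div 4)) x (push 2 (pfst ((c - 4) div 4)) k)
     else if c mod 4 = 2 then
       ev_state (pfst ((c - 4) div 4)) (pfst x)
         (push 3 (prod_encode (prod_encode (psnd ((c - 4) div 4), pfst x), prod_encode (0, psnd x))) k)
     else
       ev_state ((c - 4) div 4) (prod_encode (x, 0))
         (push 4 (prod_encode ((c - 4) div 4, prod_encode (x, 0))) k))"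

text \<open>A value \<open>v\<close> returned to a frame with tag 3 and data
  \<open>\<langle>\<langle>b, z\<rangle>, \<langle>m, n\<rangle>\<rangle>\<close> is the result of
  the first \<open>m\<close> of \<open>n\<close> rounds. Returned to tag 4 with data
  \<open>\<langle>a, \<langle>x, n\<rangle>\<rangle>\<close>, it is the value of \<open>a\<close> at
  the candidate \<open>n\<close>.\<close>

definition step_frame :: "nat \<Rightarrow> nat \<Rightarrow> nat \<Rightarrow> nat \<Rightarrow> nat" where
  "step_frame v t d k =
    (if t = 0 then ev_state (pfst d) (psnd d) (push 1 v k)
     else if t = 1 then ret_state (prod_encode (d, v)) k
     else if t = 2 then ev_state d v k
     else if t = 3 then
       if pfst (psnd d) = psnd (psnd d) then ret_state v k
       else ev_state (pfst (pfst d)) (prod_encode (psnd (pfst d), prod_encode (pfst (psnd d), v)))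
         (push 3 (prod_encode (pfst d, prod_encode (Suc (pfst (psnd d)), psnd (psnd d)))) k)
     else
       if v = 0 then ret_state (psnd (psnd d)) k
       else ev_state (pfst d) (prod_encode (pfst (psnd d), Suc (psnd (psnd d))))
         (push 4 (prod_encode (pfst d, prod_encode (pfst (psnd d), Suc (psnd (psnd d))))) k))"

text \<open>\<open>k - 1\<close> undoes the successor in \<open>push\<close>, which keeps nonempty
  stacks apart from 0. With the empty stack the state is a fixed point, so a halted machine stays
  halted.\<close>

definition step_ret :: "nat \<Rightarrow> nat \<Rightarrow> nat" where
  "step_ret v k =
    (if k = 0 then ret_state v 0
     else step_frame v (pfst (pfst (k - 1))) (psnd (pfst (k - 1))) (psnd (k - 1)))"

definition step :: "nat \<Rightarrow> nat" where
  "step s =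
    (if pfst s = 0 then step_ev (pfst (psnd s)) (pfst (psnd (psnd s))) (psnd (psnd (psnd s)))
     else step_ret (pfst (psnd s)) (psnd (psnd s)))"

definition halted :: "nat \<Rightarrow> bool" where
  "halted s \<longleftrightarrow> pfst s = 1 \<and> psnd (psnd s) = 0"

lemma computable_step: "computable step"
  unfolding step_def step_ev_def step_ret_def step_frame_def ev_state_def ret_state_def push_def
  by (intro computable_intros)

lemma decidable_halted: "computable f \<Longrightarrow> decidable {x. halted (f x)}"
  unfolding halted_def by (intro computable_intros)

lemma step_ev_state [simp]: "step (ev_state c x k) = step_ev c x k"
  by (simp add: step_def ev_state_def)

lemma step_ret_push [simp]: "step (ret_state v (push t d k)) = step_frame v t d k"
  by (simp add: step_def ret_state_def push_def step_ret_def)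

lemma halted_simps [simp]:
  "\<not> halted (ev_state c x k)" "halted (ret_state v 0)" "\<not> halted (ret_state v (push t d k))"
  by (simp_all add: halted_def ev_state_def ret_state_def push_def)

lemma four_mult_arith:
  fixes p :: nat
  shows "(4 * p + 5 - 4) div 4 = p" "(4 * p + 6 - 4) div 4 = p" "(4 * p + 7 - 4) div 4 = p"
    "(4 * p + 4) mod 4 = 0" "(4 * p + 5) mod 4 = 1" "(4 * p + 6) mod 4 = 2" "(4 * p + 7) mod 4 = 3"
  by presburger+

lemma step_ev_goedel [simp]:
  "step_ev (goedel Zero) x k = ret_state 0 k"
  "step_ev (goedel Succ) x k = ret_state (Suc x) k"
  "step_ev (goedel Fst) x k = ret_state (pfst x) k"
  "step_ev (goedel Snd) x k = ret_state (psnd x) k"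
  "step_ev (goedel (Pr a b)) x k = ev_state (goedel a) x (push 0 (prod_encode (goedel b, x)) k)"
  "step_ev (goedel (Cn a b)) x k = ev_state (goedel b) x (push 2 (goedel a) k)"
  "step_ev (goedel (Rec a b)) x k = ev_state (goedel a) (pfst x)
     (push 3 (prod_encode (prod_encode (goedel b, pfst x), prod_encode (0, psnd x))) k)"
  "step_ev (goedel (Mn a)) x k = ev_state (goedel a) (prod_encode (x, 0))
     (push 4 (prod_encode (goedel a, prod_encode (x, 0))) k)"
  by (simp_all only: step_ev_def goedel.simps four_mult_arith) simp_all

lemma step_frame_simps [simp]:
  "step_frame v 0 (prod_encode (b, x)) k = ev_state b x (push 1 v k)"
  "step_frame v 1 u k = ret_state (prod_encode (u, v)) k"
  "step_frame v (Suc 0) u k = ret_state (prod_encode (u, v)) k"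
  "step_frame v 2 a k = ev_state a v k"
  "step_frame v 3 (prod_encode (prod_encode (b, z), prod_encode (m, n))) k =
     (if m = n then ret_state v k
      else ev_state b (prod_encode (z, prod_encode (m, v)))
        (push 3 (prod_encode (prod_encode (b, z), prod_encode (Suc m, n))) k))"
  "step_frame v 4 (prod_encode (a, prod_encode (x, n))) k =
     (if v = 0 then ret_state n k
      else ev_state a (prod_encode (x, Suc n)) (push 4 (prod_encode (a, prod_encode (x, Suc n))) k))"
  by (simp_all add: step_frame_def)

declare goedel.simps [simp del]

section \<open>Completeness of the machine\<close>

definition reaches :: "nat \<Rightarrow> nat \<Rightarrow> bool" where
  "reaches s t \<longleftrightarrow> (\<exists>n. (step ^^ n) s = t)"

lemma reaches_refl [simp]: "reaches s s"
  unfolding reaches_def by (rule exI[of _ 0]) simp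

lemma reaches_step:
  assumes "reaches (step s) t"
  shows "reaches s t"
proof -
  from assms obtain n where "(step ^^ n) (step s) = t" by (auto simp: reaches_def)
  then have "(step ^^ Suc n) s = t" by (simp add: funpow_Suc_right del: funpow.simps)
  then show ?thesis unfolding reaches_def by blast
qed

lemma reaches_trans [trans]:
  assumes "reaches s t" "reaches t u"
  shows "reaches s u"
proof -
  from assms obtain m n where "(step ^^ m) s = t" "(step ^^ n) t = u" by (auto simp: reaches_def)
  then have "(step ^^ (n + m)) s = u" by (simp add: funpow_add)
  then show ?thesis unfolding reaches_def by blast
qed

text \<open>The values are defined below some zero \<open>n\<close>, and the least zero
  \<open>v\<close> is at most \<open>n\<close>; hence below \<open>v\<close> they are both defined
  and nonzero.\<close>

lemma minimise_eq_Some: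
  assumes "minimise f x = Some v"
  shows "f (prod_encode (x, v)) = Some 0"
    and "m < v \<Longrightarrow> \<exists>u. f (prod_encode (x, m)) = Some (Suc u)"
proof -
  have ex: "\<exists>n. f (prod_encode (x, n)) = Some 0 \<and> (\<forall>m<n. f (prod_encode (x, m)) \<noteq> None)"
    and v: "v = (LEAST n. f (prod_encode (x, n)) = Some 0)"
    using assms unfolding minimise_def by (auto split: if_splits)
  then obtain n where n: "f (prod_encode (x, n)) = Some 0"
    "\<And>m. m < n \<Longrightarrow> f (prod_encode (x, m)) \<noteq> None" by blast
  show "f (prod_encode (x, v)) = Some 0" unfolding v using n(1) by (rule LeastI)
  have "v \<le> n" unfolding v using n(1) by (rule Least_le)
  assume "m < v"
  then have "f (prod_encode (x, m)) \<noteq> Some 0" using not_less_Least v by blast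
  moreover obtain w where "f (prod_encode (x, m)) = Some w"
    using n(2) \<open>m < v\<close> \<open>v \<le> n\<close> by fastforce
  ultimately show "\<exists>u. f (prod_encode (x, m)) = Some (Suc u)" by (cases w) auto
qed

lemma minimise_SomeI:
  assumes "f (prod_encode (x, v)) = Some 0" "\<And>m. m < v \<Longrightarrow> \<exists>u. f (prod_encode (x, m)) = Some (Suc u)"
  shows "minimise f x = Some v"
proof -
  have "v \<le> n" if "f (prod_encode (x, n)) = Some 0" for n
    using assms(2)[of n] that by (cases "v \<le> n") auto
  then have "(LEAST n. f (prod_encode (x, n)) = Some 0) = v"
    using assms(1) by (intro Least_equality)
  moreover have "\<forall>m<v. f (prod_encode (x, m)) \<noteq> None" using assms(2) by fastforce
  ultimately show ?thesis unfolding minimise_def using assms(1) by auto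
qed

text \<open>The stack \<open>k\<close> is arbitrary, so that the induction hypotheses apply to
  subprograms running with a further frame on top.\<close>

lemma reaches_eval:
  "eval c x = Some v \<Longrightarrow> reaches (ev_state (goedel c) x k) (ret_state v k)"
proof (induction c arbitrary: x v k)
  case (Pr a b)
  from Pr.prems obtain u w where u: "eval a x = Some u" "eval b x = Some w" "v = prod_encode (u, w)"
    by (auto simp: bind_eq_Some_conv)
  have "reaches (ev_state (goedel (Pr a b)) x k)
      (ret_state u (push 0 (prod_encode (goedel b, x)) k))"
    by (rule reaches_step) (use Pr.IH(1)[OF u(1)] in \<open>simp\<close>)
  also have "reaches \<dots> (ret_state w (push 1 u k))"
    by (rule reaches_step) (use Pr.IH(2)[OF u(2)] in \<open>simp\<close>)
  also have "reaches \<dots> (ret_state v k)"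
    by (rule reaches_step) (simp add: u(3))
  finally show ?case .
next
  case (Cn a b)
  from Cn.prems obtain u where u: "eval b x = Some u" "eval a u = Some v"
    by (auto simp: bind_eq_Some_conv)
  have "reaches (ev_state (goedel (Cn a b)) x k) (ret_state u (push 2 (goedel a) k))"
    by (rule reaches_step) (use Cn.IH(2)[OF u(1)] in \<open>simp\<close>)
  also have "reaches \<dots> (ret_state v k)"
    by (rule reaches_step) (use Cn.IH(1)[OF u(2)] in \<open>simp\<close>)
  finally show ?case .
next
  case (Rec a b)
  define z n where "z = pfst x" and "n = psnd x"
  define F where "F = rec_nat (eval a z)
    (\<lambda>m r. Option.bind r (\<lambda>u. eval b (prod_encode (z, prod_encode (m, u)))))"
  have Fn: "F n = Some v"
    using Rec.prems by (simp add: F_def z_def n_def split_beta)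
  \<comment> \<open>Loop invariant: after \<open>m\<close> rounds the value \<open>F m\<close>
    returns to a frame whose counter is \<open>m\<close>.\<close>
  have "reaches (ev_state (goedel (Rec a b)) x k) (ret_state u
      (push 3 (prod_encode (prod_encode (goedel b, z), prod_encode (m, n))) k))"
    if "m \<le> n" "F m = Some u" for m u
    using that
  proof (induction m arbitrary: u)
    case 0
    then have a: "eval a z = Some u" by (simp add: F_def)
    show ?case
      by (rule reaches_step)
        (use Rec.IH(1)[OF a] in \<open>simp add: z_def n_def\<close>)
  next
    case (Suc m)
    from Suc.prems(2) obtain w where w: "F m = Some w" "eval b (prod_encode (z, prod_encode (m, w))) = Some u"
      by (auto simp: F_def bind_eq_Some_conv)
    have "reaches (ret_state w (push 3 (prod_encode (prod_encode (goedel b, z), prod_encode (m, n))) k))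
      (ret_state u (push 3 (prod_encode (prod_encode (goedel b, z), prod_encode (Suc m, n))) k))"
      by (rule reaches_step) (use Rec.IH(2)[OF w(2)] Suc.prems in \<open>simp\<close>)
    with Suc.IH[OF _ w(1)] show ?case using Suc.prems(1) by (meson Suc_leD reaches_trans)
  qed
  from this[OF order_refl Fn] have "reaches (ev_state (goedel (Rec a b)) x k) (ret_state v
      (push 3 (prod_encode (prod_encode (goedel b, z), prod_encode (n, n))) k))" .
  also have "reaches \<dots> (ret_state v k)"
    by (rule reaches_step) simp
  finally show ?case .
next
  case (Mn a)
  note v = minimise_eq_Some[OF Mn.prems[unfolded eval.simps]]
  \<comment> \<open>Loop invariant: the search arrives at every candidate up to the least zero
    \<open>v\<close>.\<close>
  have "reaches (ev_state (goedel (Mn a)) x k) (ev_state (goedel a) (prod_encode (x, n))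
      (push 4 (prod_encode (goedel a, prod_encode (x, n))) k))"
    if "n \<le> v" for n
    using that
  proof (induction n)
    case 0
    show ?case by (rule reaches_step) simp
  next
    case (Suc n)
    then obtain u where "eval a (prod_encode (x, n)) = Some (Suc u)"
      using v(2)[of n] by auto
    note step = Mn.IH[OF this]
    have "reaches (ev_state (goedel (Mn a)) x k) (ev_state (goedel a) (prod_encode (x, n))
      (push 4 (prod_encode (goedel a, prod_encode (x, n))) k))"
      using Suc by simp
    also have "reaches \<dots>
      (ret_state (Suc u) (push 4 (prod_encode (goedel a, prod_encode (x, n))) k))" by (rule step)
    also have "reaches \<dots> (ev_state (goedel a) (prod_encode (x, Suc n))
      (push 4 (prod_encode (goedel a, prod_encode (x, Suc n))) k))"
      by (rule reaches_step) simp
    finally show ?case .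
  qed
  from this[OF order_refl]
  have "reaches (ev_state (goedel (Mn a)) x k) (ev_state (goedel a) (prod_encode (x, v))
      (push 4 (prod_encode (goedel a, prod_encode (x, v))) k))" .
  also have "reaches \<dots> (ret_state 0 (push 4 (prod_encode (goedel a, prod_encode (x, v))) k))"
    by (rule Mn.IH[OF v(1)])
  also have "reaches \<dots> (ret_state v k)"
    by (rule reaches_step) simp
  finally show ?case .
qed (rule reaches_step, simp)+

section \<open>Soundness of the machine\<close>

definition halts_in :: "nat \<Rightarrow> nat \<Rightarrow> bool" where
  "halts_in n s \<longleftrightarrow> halted ((step ^^ n) s)"

lemma halts_inE:
  assumes "halts_in n s" "\<not> halted s"
  obtains m where "n = Suc m" "halts_in m (step s)"
  using assms by (cases n) (simp_all add: halts_in_def funpow_Suc_right del: funpow.simps(2))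

lemma halts_in_evE:
  assumes "halts_in n (ev_state c x k)"
  obtains m where "m < n" "halts_in m (step_ev c x k)"
  by (rule halts_inE[OF assms]) (auto intro: that)

lemma halts_in_pushE:
  assumes "halts_in n (ret_state v (push t d k))"
  obtains m where "m < n" "halts_in m (step_frame v t d k)"
  by (rule halts_inE[OF assms]) (auto intro: that)

text \<open>Before the machine can halt, the program must hand its value to the stack
  \<open>k\<close>. The strict bound \<open>m < n\<close> on the remaining run time supports the
  inductions over the loops of \<open>Rec\<close> and \<open>Mn\<close>.\<close>

lemma halts_in_eval:
  "halts_in n (ev_state (goedel c) x k) \<Longrightarrow>
    \<exists>v m. m < n \<and> eval c x = Some v \<and> halts_in m (ret_state v k)"
proof (induction c arbitrary: n x k)
  case (Pr a b)
  from Pr.prems obtain m1 where m1: "m1 < n"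
    "halts_in m1 (ev_state (goedel a) x (push 0 (prod_encode (goedel b, x)) k))"
    by (rule halts_in_evE) simp
  from Pr.IH(1)[OF m1(2)] obtain u m2 where m2: "m2 < m1" "eval a x = Some u"
    "halts_in m2 (ret_state u (push 0 (prod_encode (goedel b, x)) k))" by blast
  from m2(3) obtain m3 where m3: "m3 < m2" "halts_in m3 (ev_state (goedel b) x (push 1 u k))"
    by (rule halts_in_pushE) simp
  from Pr.IH(2)[OF m3(2)] obtain w m4 where m4: "m4 < m3" "eval b x = Some w"
    "halts_in m4 (ret_state w (push 1 u k))" by blast
  from m4(3) obtain m5 where m5: "m5 < m4" "halts_in m5 (ret_state (prod_encode (u, w)) k)"
    by (rule halts_in_pushE) simp
  have "m5 < n" using m1(1) m2(1) m3(1) m4(1) m5(1) by linarith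
  then show ?case using m2(2) m4(2) m5(2) by auto
next
  case (Cn a b)
  from Cn.prems obtain m1 where m1: "m1 < n"
    "halts_in m1 (ev_state (goedel b) x (push 2 (goedel a) k))"
    by (rule halts_in_evE) simp
  from Cn.IH(2)[OF m1(2)] obtain u m2 where m2: "m2 < m1" "eval b x = Some u"
    "halts_in m2 (ret_state u (push 2 (goedel a) k))" by blast
  from m2(3) obtain m3 where m3: "m3 < m2" "halts_in m3 (ev_state (goedel a) u k)"
    by (rule halts_in_pushE) simp
  from Cn.IH(1)[OF m3(2)] obtain w m4 where m4: "m4 < m3" "eval a u = Some w"
    "halts_in m4 (ret_state w k)" by blast
  have "m4 < n" using m1(1) m2(1) m3(1) m4(1) by linarith
  then show ?case using m2(2) m4(2,3) by auto
next
  case (Rec a b)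
  define z N where "z = pfst x" and "N = psnd x"
  define F where "F = rec_nat (eval a z)
    (\<lambda>m r. Option.bind r (\<lambda>u. eval b (prod_encode (z, prod_encode (m, u)))))"
  have F: "eval (Rec a b) x = F N"
    by (simp add: F_def z_def N_def split_beta)
  \<comment> \<open>Induction on the remaining run time \<open>l\<close>, which drops in every round
    while the counter \<open>i\<close> rises towards \<open>N\<close>.\<close>
  have loop: "\<exists>v l'. l' < l \<and> F N = Some v \<and> halts_in l' (ret_state v k)"
    if "halts_in l (ret_state u (push 3
          (prod_encode (prod_encode (goedel b, z), prod_encode (i, N))) k))" "F i = Some u" for l i u
    using that
  proof (induction l arbitrary: i u rule: less_induct)
    case (less l)
    from less.prems(1) obtain l1 where l1: "l1 < l" "halts_in l1 (step_frame u 3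
      (prod_encode (prod_encode (goedel b, z), prod_encode (i, N))) k)"
      by (rule halts_in_pushE)
    show ?case
    proof (cases "i = N")
      case True
      then show ?thesis using l1 less.prems(2) by auto
    next
      case False
      with l1(2) have "halts_in l1 (ev_state (goedel b) (prod_encode (z, prod_encode (i, u)))
        (push 3 (prod_encode (prod_encode (goedel b, z), prod_encode (Suc i, N))) k))" by simp
      from Rec.IH(2)[OF this] obtain w l2 where l2: "l2 < l1"
        "eval b (prod_encode (z, prod_encode (i, u))) = Some w"
        "halts_in l2 (ret_state w (push 3 (prod_encode (prod_encode (goedel b, z),
          prod_encode (Suc i, N))) k))" by blast
      have "F (Suc i) = Some w" using less.prems(2) l2(2) by (simp add: F_def)
      from less.IH[OF _ l2(3) this] l1(1) l2(1) show ?thesis by (meson less_trans)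
    qed
  qed
  from Rec.prems obtain m1 where m1: "m1 < n" "halts_in m1 (ev_state (goedel a) z
      (push 3 (prod_encode (prod_encode (goedel b, z), prod_encode (0, N))) k))"
    by (rule halts_in_evE) (simp add: z_def N_def)
  from Rec.IH(1)[OF m1(2)] obtain u m2 where m2: "m2 < m1" "eval a z = Some u"
    "halts_in m2 (ret_state u
      (push 3 (prod_encode (prod_encode (goedel b, z), prod_encode (0, N))) k))" by blast
  have "F 0 = Some u" using m2(2) by (simp add: F_def)
  from loop[OF m2(3) this] show ?case unfolding F using m1(1) m2(1) by (meson less_trans)
next
  case (Mn a)
  \<comment> \<open>The search has no bound known in advance; the remaining run time
    \<open>l\<close> provides one.\<close>
  have loop: "\<exists>v l'. l' < l \<and> minimise (eval a) x = Some v \<and> halts_in l' (ret_state v k)"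
    if "halts_in l (ev_state (goedel a) (prod_encode (x, i))
          (push 4 (prod_encode (goedel a, prod_encode (x, i))) k))"
      "\<And>j. j < i \<Longrightarrow> \<exists>u. eval a (prod_encode (x, j)) = Some (Suc u)" for l i
    using that
  proof (induction l arbitrary: i rule: less_induct)
    case (less l)
    from Mn.IH[OF less.prems(1)] obtain u l1 where l1: "l1 < l"
      "eval a (prod_encode (x, i)) = Some u"
      "halts_in l1 (ret_state u (push 4 (prod_encode (goedel a, prod_encode (x, i))) k))" by blast
    from l1(3) obtain l2 where l2: "l2 < l1"
      "halts_in l2 (step_frame u 4 (prod_encode (goedel a, prod_encode (x, i))) k)"
      by (rule halts_in_pushE)
    show ?case
    proof (cases u)
      case 0
      then have "minimise (eval a) x = Some i"
        using l1(2) less.prems(2) by (intro minimise_SomeI) auto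
      moreover have "l2 < l" "halts_in l2 (ret_state i k)" using l1(1) l2 0 by auto
      ultimately show ?thesis by auto
    next
      case (Suc w)
      then have "halts_in l2 (ev_state (goedel a) (prod_encode (x, Suc i))
          (push 4 (prod_encode (goedel a, prod_encode (x, Suc i))) k))"
        using l2(2) by simp
      moreover have "\<exists>u. eval a (prod_encode (x, j)) = Some (Suc u)" if "j < Suc i" for j
        using that less.prems(2) l1(2) Suc by (cases "j = i") auto
      ultimately have "\<exists>v l'. l' < l2 \<and> minimise (eval a) x = Some v \<and> halts_in l' (ret_state v k)"
        using l1(1) l2(1) by (intro less.IH) auto
      then show ?thesis using l1(1) l2(1) by (meson less_trans)
    qed
  qed
  from Mn.prems obtain m1 where m1: "m1 < n" "halts_in m1 (ev_state (goedel a) (prod_encode (x, 0))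
      (push 4 (prod_encode (goedel a, prod_encode (x, 0))) k))"
    by (rule halts_in_evE) simp
  from loop[OF m1(2)] m1(1) show ?case by (simp, meson less_trans)
qed (erule halts_in_evE, auto)+

definition converges_in :: "nat \<Rightarrow> nat \<Rightarrow> nat \<Rightarrow> bool" where
  "converges_in i x s \<longleftrightarrow> halts_in s (ev_state i x 0)"

lemma in_re_set_iff: "x \<in> re_set i \<longleftrightarrow> (\<exists>s. converges_in i x s)"
proof -
  define c where "c = the_inv goedel i"
  have i: "i = goedel c"
    unfolding c_def using bij_goedel by (metis bij_def f_the_inv_into_f UNIV_I)
  show ?thesis
  proof
    assume "x \<in> re_set i"
    then obtain v where "eval c x = Some v" by (auto simp: re_set_def c_def)
    from reaches_eval[OF this, of 0] show "\<exists>s. converges_in i x s"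
      unfolding converges_in_def halts_in_def reaches_def i by (metis halted_simps(2))
  next
    assume "\<exists>s. converges_in i x s"
    then have "\<exists>v. eval c x = Some v"
      unfolding converges_in_def i using halts_in_eval by blast
    then show "x \<in> re_set i" by (auto simp: re_set_def c_def)
  qed
qed

lemma decidable_converges_in:
  assumes "computable f" "computable g" "computable h"
  shows "decidable {x. converges_in (f x) (g x) (h x)}"
  unfolding converges_in_def halts_in_def ev_state_def
  by (intro decidable_halted computable_funpow computable_step assms computable_intros)

section \<open>Isomorphism and heights\<close>

abbreviation prime_at :: "nat \<Rightarrow> nat" where
  "prime_at k \<equiv> enumerate {p. prime p} k"

lemma prime_prime_at: "prime (prime_at k)"
  using enumerate_in_set[OF primes_infinite, of k] by simp

lemma prime_at_surj: "prime p \<Longrightarrow> \<exists>k. prime_at k = p"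
  using enumerate_Ex[of "{p. prime p}" p] primes_infinite by auto

lemma prime_at_eq_iff: "prime_at k = prime_at l \<longleftrightarrow> k = l"
  using inj_enumerate[OF primes_infinite] by (auto dest: injD)

text \<open>\<open>height_ge i k y\<close> says that the denominators of \<open>G i\<close> admit the \<open>y\<close>th power of the prime
  with (zero-based) index \<open>k\<close>.\<close>

definition height_ge :: "nat \<Rightarrow> nat \<Rightarrow> nat \<Rightarrow> bool" where
  "height_ge i k y \<longleftrightarrow> y = 0 \<or> (Suc k, y) \<in> W i"

lemma height_ge_mono: "height_ge i k y \<Longrightarrow> z \<le> y \<Longrightarrow> height_ge i k z"
  unfolding height_ge_def W_def by (auto intro: order_trans)

lemma height_ge_0 [simp]: "height_ge i k 0"
  by (simp add: height_ge_def)

text \<open>By \<open>carrier_G\<close> below, these are the admissible denominators of the elements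
  of \<open>G i\<close>.\<close>

definition denoms :: "nat \<Rightarrow> nat set" where
  "denoms i = {d. d > 0 \<and> (\<forall>k. height_ge i k (multiplicity (prime_at k) d))}"

lemma denoms_dvd: "d \<in> denoms i \<Longrightarrow> e dvd d \<Longrightarrow> e \<in> denoms i"
  unfolding denoms_def
  by (auto intro: height_ge_mono dvd_imp_multiplicity_le dvd_pos_nat)

lemma one_in_denoms: "1 \<in> denoms i"
  by (simp add: denoms_def)

lemma prime_power_in_denoms: "height_ge i k y \<Longrightarrow> prime_at k ^ y \<in> denoms i"
  unfolding denoms_def
  by (auto simp: prime_gt_0_nat prime_prime_at multiplicity_distinct_prime_power prime_at_eq_iff)
    (metis height_ge_0 multiplicity_distinct_prime_power multiplicity_same_power not_prime_0
      not_prime_unit prime_at_eq_iff prime_prime_at)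

lemma lcm_in_denoms:
  assumes "d \<in> denoms i" "e \<in> denoms i"
  shows "lcm d e \<in> denoms i"
proof -
  have "multiplicity (prime_at k) (lcm d e) =
      max (multiplicity (prime_at k) d) (multiplicity (prime_at k) e)" for k
    using assms prime_prime_at by (intro multiplicity_lcm) (auto simp: denoms_def)
  then show ?thesis
    using assms by (auto simp: denoms_def max_def lcm_pos_nat)
qed

section \<open>The carrier of \<open>G i\<close>\<close>

lemma inv_rat_group: "inv\<^bsub>rat_group\<^esub> x = - x"
proof -
  interpret group rat_group by (rule group_rat_group)
  show ?thesis by (rule inv_equality) (simp_all add: rat_group_def)
qed

lemma group_G: "group (G i)"
  unfolding G_def by (rule group.group_subgroup_generated[OF group_rat_group])

lemma mult_G: "x \<otimes>\<^bsub>G i\<^esub> y = x + y"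
  by (simp add: G_def subgroup_generated_def rat_group_def)

lemma G_generate: "carrier (G i) =
    generate rat_group (insert 1 {1 / of_nat (nth_prime x ^ y) | x y. (x, y) \<in> W i})"
  unfolding G_def carrier_subgroup_generated by (simp add: rat_group_def)

lemma carrier_G_induct [consumes 1, case_names zero minus add one prime_power]:
  assumes "x \<in> carrier (G i)" and "P 0" "\<And>x. P x \<Longrightarrow> P (- x)" "\<And>x y. P x \<Longrightarrow> P y \<Longrightarrow> P (x + y)"
    and "P 1" "\<And>k y. height_ge i k y \<Longrightarrow> P (1 / of_nat (prime_at k ^ y))"
  shows "P x"
proof -
  have gen: "P h" if "h \<in> insert 1 {1 / of_nat (nth_prime x ^ y) | x y. (x, y) \<in> W i}" for h
    using that
  proof
    assume "h \<in> {1 / of_nat (nth_prime x ^ y) | x y. (x, y) \<in> W i}"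
    then obtain x y where xy: "h = 1 / of_nat (nth_prime x ^ y)" "(x, y) \<in> W i" by blast
    \<comment> \<open>A generator with \<open>x = 0\<close> equals 1, because
      \<open>nth_prime 0 = 1\<close>; otherwise \<open>x - 1\<close> is the zero-based index of the
      prime.\<close>
    then show "P h"
      using assms(5) assms(6)[of "x - 1" y] by (cases x) (auto simp: height_ge_def)
  qed (use assms(5) in simp)
  show ?thesis
    using assms(1) unfolding G_generate
    by (induction rule: generate.induct)
      (use assms(2-4) gen in \<open>auto simp: inv_rat_group\<close>, auto simp: rat_group_def assms)
qed

lemma zero_in_G: "0 \<in> carrier (G i)"
  using group.is_monoid[OF group_G, of i, THEN monoid.one_closed]
  by (simp add: G_def subgroup_generated_def rat_group_def)

lemma add_in_G: "x \<in> carrier (G i) \<Longrightarrow> y \<in> carrier (G i) \<Longrightarrow> x + y \<in> carrier (G i)"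
  using monoid.m_closed[OF group.is_monoid[OF group_G], of x i y] by (simp add: mult_G)

lemma uminus_in_G:
  assumes "x \<in> carrier (G i)"
  shows "- x \<in> carrier (G i)"
proof -
  have "inv\<^bsub>G i\<^esub> x = - x"
    using assms group.l_inv[OF group_G assms]
    by (simp add: mult_G) (simp add: G_def subgroup_generated_def rat_group_def)
  then show ?thesis using group.inv_closed[OF group_G assms] by simp
qed

lemma of_int_mult_in_G:
  assumes "x \<in> carrier (G i)"
  shows "of_int a * x \<in> carrier (G i)"
proof (induction a rule: int_induct[of _ 0])
  case base
  then show ?case by (simp add: zero_in_G)
next
  case (step1 a)
  then show ?case using add_in_G[OF _ assms] by (simp add: distrib_right)
next
  case (step2 a)
  then show ?case using add_in_G[OF _ uminus_in_G[OF assms]] by (simp add: left_diff_distrib)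
qed

lemma one_in_G: "1 \<in> carrier (G i)"
  unfolding G_generate by (rule generate.incl) simp

lemma inverse_prime_power_in_G:
  assumes "height_ge i k y"
  shows "1 / of_nat (prime_at k ^ y) \<in> carrier (G i)"
proof (cases "y = 0")
  case True
  then show ?thesis by (simp add: one_in_G)
next
  case False
  with assms have "(Suc k, y) \<in> W i" by (simp add: height_ge_def)
  then have "\<exists>x z. 1 / of_nat (prime_at k ^ y) = (1 / of_nat (nth_prime x ^ z) :: rat) \<and> (x, z) \<in> W i"
    by (metis nth_prime.simps(2))
  then show ?thesis unfolding G_generate by (intro generate.incl insertI2) blast
qed

text \<open>Partial fractions: split off the full power \<open>p ^ y\<close> of a prime from
  \<open>d\<close>. The cofactor \<open>e\<close> is smaller and coprime to it, and a Bezout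
  identity combines \<open>1 / e\<close> and \<open>1 / p ^ y\<close> into
  \<open>1 / d\<close>.\<close>

lemma inverse_denom_in_G: "d \<in> denoms i \<Longrightarrow> 1 / of_nat d \<in> carrier (G i)"
proof (induction d rule: less_induct)
  case (less d)
  show ?case
  proof (cases "d = 1")
    case True
    then show ?thesis by (simp add: one_in_G)
  next
    case False
    then obtain p where p: "prime p" "p dvd d" using prime_factor_nat by blast
    then obtain k where k: "p = prime_at k" using prime_at_surj by blast
    define y where "y = multiplicity p d"
    have d: "d > 0" "height_ge i k y"
      using less.prems by (auto simp: denoms_def y_def k)
    obtain e where e: "d = p ^ y * e" "\<not> p dvd e"
      using multiplicity_decompose'[of d p] p d(1) unfolding y_def by (metis not_prime_unit neq0_conv)
    have "y > 0" using p d(1) by (simp add: y_def prime_multiplicity_gt_zero_iff)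
    then have "p ^ y > 1" using p(1) prime_gt_1_nat one_less_power by blast
    moreover have "e > 0" using d(1) e(1) by (cases e) auto
    ultimately have "e < d" using e(1) by simp
    moreover have "e \<in> denoms i" using denoms_dvd less.prems e(1) dvd_triv_right by blast
    ultimately have e': "1 / of_nat e \<in> carrier (G i)" by (rule less.IH)
    have p': "1 / of_nat (p ^ y) \<in> carrier (G i)"
      using inverse_prime_power_in_G[OF d(2)] k by simp
    have "coprime (p ^ y) e" using p(1) e(2) by (simp add: prime_imp_coprime)
    then have "coprime (int (p ^ y)) (int e)" by (simp only: coprime_int_iff)
    then obtain u v where uv: "u * int (p ^ y) + v * int e = 1"
      using bezout_int[of "int (p ^ y)" "int e"] by auto
    have "1 / of_nat d = (of_int (u * int (p ^ y) + v * int e) / (of_nat (p ^ y) * of_nat e) :: rat)"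
      unfolding uv e(1) by simp
    also have "\<dots> = of_int u * (1 / of_nat e) + of_int v * (1 / of_nat (p ^ y))"
      using \<open>e > 0\<close> prime_gt_0_nat[OF p(1)] by (simp add: add_divide_distrib)
    finally have "1 / of_nat d = of_int u * (1 / of_nat e) + of_int v * (1 / (of_nat (p ^ y) :: rat))" .
    then show ?thesis using e' p' by (simp only: add_in_G of_int_mult_in_G)
  qed
qed

lemma carrier_G: "carrier (G i) = {of_int a / of_nat d | a d. d \<in> denoms i}" (is "_ = ?R")
proof
  show "carrier (G i) \<subseteq> ?R"
  proof
    fix x assume "x \<in> carrier (G i)"
    then show "x \<in> ?R"
    proof (induction rule: carrier_G_induct)
      case zero
      have "(0::rat) = of_int 0 / of_nat 1" by simp
      then show ?case using one_in_denoms by blast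
    next
      case (minus x)
      then obtain a d where "x = of_int a / of_nat d" "d \<in> denoms i" by blast
      then have "- x = of_int (- a) / of_nat d" by simp
      then show ?case using \<open>d \<in> denoms i\<close> by blast
    next
      case (add x y)
      then obtain a d b e where xy: "x = of_int a / of_nat d" "y = of_int b / of_nat e"
        and de: "d \<in> denoms i" "e \<in> denoms i" by blast
      then have pos: "d > 0" "e > 0" by (auto simp: denoms_def)
      obtain d' e' where l: "lcm d e = d * d'" "lcm d e = e * e'" by (meson dvd_def dvd_lcm1 dvd_lcm2)
      have "lcm d e > 0" using pos by (simp add: lcm_pos_nat)
      then have "d' > 0" "e' > 0" using l by (auto intro: gr0I)
      have "x = of_int (a * int d') / of_nat (lcm d e)"
        unfolding l(1) xy using \<open>d' > 0\<close> by simp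
      moreover have "y = of_int (b * int e') / of_nat (lcm d e)"
        unfolding l(2) xy using \<open>e' > 0\<close> by simp
      ultimately have "x + y = of_int (a * int d' + b * int e') / of_nat (lcm d e)"
        by (simp add: add_divide_distrib)
      then show ?case using lcm_in_denoms[OF de] by blast
    next
      case one
      have "(1::rat) = of_int 1 / of_nat 1" by simp
      then show ?case using one_in_denoms by blast
    next
      case (prime_power k y)
      have "1 / of_nat (prime_at k ^ y) = (of_int 1 / of_nat (prime_at k ^ y) :: rat)" by simp
      then show ?case using prime_power_in_denoms[OF prime_power] by blast
    qed
  qed
next
  show "?R \<subseteq> carrier (G i)"
  proof
    fix x :: rat assume "x \<in> ?R"
    then obtain a d where "x = of_int a * (1 / of_nat d)" "d \<in> denoms i" by auto
    then show "x \<in> carrier (G i)" by (simp only: of_int_mult_in_G inverse_denom_in_G)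
  qed
qed

text \<open>Up to the finitely many finite discrepancies allowed in the types of isomorphic groups, the
  heights in \<open>G i\<close> are at most those in \<open>G j\<close>.\<close>

definition height_le_upto :: "nat \<Rightarrow> nat \<Rightarrow> nat \<Rightarrow> bool" where
  "height_le_upto K i j \<longleftrightarrow>
    (\<forall>k y. height_ge i k (y + (if k < K then K else 0)) \<longrightarrow> height_ge j k y)"

lemma height_le_upto_mono:
  assumes "height_le_upto K i j" "K \<le> L"
  shows "height_le_upto L i j"
  unfolding height_le_upto_def
proof (intro allI impI)
  fix k y assume "height_ge i k (y + (if k < L then L else 0))"
  then have "height_ge i k (y + (if k < K then K else 0))"
    by (rule height_ge_mono) (use assms(2) in auto)
  then show "height_ge j k y" using assms(1) by (simp add: height_le_upto_def)
qed

text \<open>The image of 1 is a fixed nonzero fraction \<open>a / e\<close>. If 1 is divisible by a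
  prime power in \<open>G i\<close>, so is its image in \<open>G j\<close>; apart from the factors
  of that prime in the numerator \<open>a\<close>, the power has to occur in a denominator.\<close>

lemma embedding_imp_height_le_upto:
  assumes hom: "h \<in> hom (G i) (G j)" and inj: "inj_on h (carrier (G i))"
  shows "\<exists>K. height_le_upto K i j"
proof -
  have add: "h (x + y) = h x + h y" if "x \<in> carrier (G i)" "y \<in> carrier (G i)" for x y
    using hom_mult[OF hom that] by (simp add: mult_G)
  have h0: "h 0 = 0" using add[OF zero_in_G zero_in_G] by simp
  have scale: "of_nat n * x \<in> carrier (G i) \<and> h (of_nat n * x) = of_nat n * h x"
    if "x \<in> carrier (G i)" for n x
  proof (induction n)
    case 0
    then show ?case by (simp add: h0 zero_in_G)
  next
    case (Suc n)
    then show ?case using add[of "of_nat n * x" x] add_in_G[of "of_nat n * x" i x] that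
      by (simp add: algebra_simps)
  qed
  have carr: "h x \<in> carrier (G j)" if "x \<in> carrier (G i)" for x
    using hom_in_carrier[OF hom that] .
  obtain a e where ae: "h 1 = of_int a / of_nat e" "e \<in> denoms j"
    using carr[OF one_in_G] unfolding carrier_G by blast
  have "h 1 \<noteq> 0" using inj_onD[OF inj, of 1 0] h0 one_in_G zero_in_G by auto
  then have "a \<noteq> 0" using ae by auto
  define A where "A = nat \<bar>a\<bar>"
  have A: "A > 0" using \<open>a \<noteq> 0\<close> by (simp add: A_def)
  \<comment> \<open>A prime with index at least \<open>Suc A\<close> exceeds \<open>A\<close> and
    does not divide it; any other prime has multiplicity below \<open>Suc A\<close> in
    \<open>A\<close>.\<close>
  have "height_le_upto (Suc A) i j"
    unfolding height_le_upto_def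
  proof (intro allI impI)
    fix k y
    define s where "s = (if k < Suc A then Suc A else 0)"
    define p where "p = prime_at k"
    have p: "prime p" by (simp add: p_def prime_prime_at)
    assume "height_ge i k (y + (if k < Suc A then Suc A else 0))"
    then have *: "1 / of_nat (p ^ (y + s)) \<in> carrier (G i)"
      unfolding s_def p_def by (rule inverse_prime_power_in_G)
    then obtain b d where bd: "h (1 / of_nat (p ^ (y + s))) = of_int b / of_nat d" "d \<in> denoms j"
      using carr unfolding carrier_G[of j] by blast
    have pos: "d > 0" "e > 0" "p > 0" using bd(2) ae(2) p by (auto simp: denoms_def prime_gt_0_nat)
    have "of_nat (p ^ (y + s)) * (1 / of_nat (p ^ (y + s))) = (1::rat)"
      using pos by simp
    then have "h 1 = of_nat (p ^ (y + s)) * (of_int b / of_nat d)"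
      using scale[OF *, of "p ^ (y + s)"] bd(1) by simp
    then have "of_int (a * int d) = (of_int (int (p ^ (y + s)) * (b * int e)) :: rat)"
      unfolding ae(1) using pos by (simp add: field_simps)
    then have "a * int d = int (p ^ (y + s)) * (b * int e)" by (simp only: of_int_eq_iff)
    then have "int (p ^ (y + s)) dvd a * int d" by simp
    then have "int (p ^ (y + s)) dvd int (A * d)"
      unfolding A_def
      by (metis abs_mult abs_of_nat dvd_abs_iff int_nat_eq abs_ge_zero of_nat_mult)
    then have "p ^ (y + s) dvd A * d" by (simp only: int_dvd_int_iff)
    then have "y + s \<le> multiplicity p (A * d)"
      using A pos p by (intro multiplicity_geI) (auto simp: prime_gt_1_nat)
    also have "\<dots> = multiplicity p A + multiplicity p d"
      using A pos p by (intro prime_elem_multiplicity_mult_distrib) auto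
    also have "multiplicity p A \<le> s"
    proof (cases "k < Suc A")
      case True
      have "p ^ multiplicity p A \<le> A" using A by (intro dvd_imp_le multiplicity_dvd)
      moreover have "multiplicity p A < p ^ multiplicity p A"
        using prime_gt_1_nat[OF p] by (intro power_gt_expt) simp
      ultimately show ?thesis using True by (simp add: s_def)
    next
      case False
      have "k \<le> p" unfolding p_def by (rule le_enumerate[OF primes_infinite])
      then have "\<not> p dvd A" using False A by (auto dest: dvd_imp_le)
      then show ?thesis by (simp add: not_dvd_imp_multiplicity_0)
    qed
    finally have "y \<le> multiplicity p d" by simp
    moreover have "height_ge j k (multiplicity p d)" using bd(2) by (simp add: denoms_def p_def)
    ultimately show "height_ge j k y" by (rule height_ge_mono[rotated])
  qed
  then show ?thesis by blast
qed

section \<open>Isomorphisms from matching heights\<close>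

lemma multiplicity_prime_at_power:
  "multiplicity (prime_at l) (prime_at k ^ y) = (if l = k then y else 0)"
  using prime_prime_at[of k] prime_prime_at[of l]
  by (auto simp: multiplicity_distinct_prime_power prime_at_eq_iff multiplicity_same_power)

lemma multiplicity_prime_at_prod:
  "multiplicity (prime_at l) (\<Prod>k<K. prime_at k ^ b k) = (if l < K then b l else 0)"
proof (induction K)
  case (Suc K)
  have "(\<Prod>k<K. prime_at k ^ b k) \<noteq> 0" "prime_at K ^ b K \<noteq> 0"
    using prime_prime_at by (auto simp: prime_gt_0_nat)
  then have "multiplicity (prime_at l) ((\<Prod>k<K. prime_at k ^ b k) * prime_at K ^ b K) =
      (if l < K then b l else 0) + multiplicity (prime_at l) (prime_at K ^ b K)"
    using Suc prime_prime_at by (subst prime_elem_multiplicity_mult_distrib) auto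
  moreover have "multiplicity (prime_at l) (prime_at K ^ b K) = (if l = K then b K else 0)"
    by (rule multiplicity_prime_at_power)
  ultimately show ?case by (auto simp: less_Suc_eq)
qed simp

text \<open>Multiplication by the quotient of the two products cancels \<open>a k\<close> factors of
  the \<open>k\<close>th prime from a denominator and adds \<open>b k\<close>. It suffices to check
  this on generators.\<close>

lemma scale_carrier_G:
  assumes ab: "\<And>k y. height_ge i k (y + a k) \<Longrightarrow> height_ge j k (y + b k)"
    and b: "\<And>k. height_ge j k (b k)"
    and 0: "\<And>k. K \<le> k \<Longrightarrow> a k = 0 \<and> b k = 0"
    and x: "x \<in> carrier (G i)"
  shows "x * (of_nat (\<Prod>k<K. prime_at k ^ a k) / of_nat (\<Prod>k<K. prime_at k ^ b k)) \<in> carrier (G j)"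
    (is "x * (of_nat ?m / of_nat ?n) \<in> _")
proof -
  have pos: "?n > 0" by (auto intro!: prod_pos simp: prime_gt_0_nat prime_prime_at)
  have mult_n: "multiplicity (prime_at l) ?n = b l" for l
    using 0[of l] by (simp add: multiplicity_prime_at_prod)
  have "?n \<in> denoms j" using pos b by (auto simp: denoms_def mult_n)
  note n_inv = inverse_denom_in_G[OF this]
  from x show ?thesis
  proof (induction rule: carrier_G_induct)
    case zero
    then show ?case by (simp add: zero_in_G)
  next
    case (minus x)
    then show ?case using uminus_in_G unfolding mult_minus_left by blast
  next
    case (add x y)
    then show ?case using add_in_G unfolding distrib_right by blast
  next
    case one
    show ?case using of_int_mult_in_G[OF n_inv, of "int ?m"] by simp
  next
    case (prime_power k y)
    define p where "p = prime_at k"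
    have p: "p > 0" "prime p" by (simp_all add: p_def prime_gt_0_nat prime_prime_at)
    have m: "?m \<noteq> 0" "multiplicity p ?m = a k"
      using 0[of k] by (auto simp: p_def multiplicity_prime_at_prod prime_gt_0_nat prime_prime_at)
    obtain m' where m': "?m = p ^ a k * m'" using multiplicity_dvd[of p ?m] m(2) by (auto elim: dvdE)
    show ?case
    proof (cases "y \<le> a k")
      \<comment> \<open>The numerator absorbs all of \<open>p ^ y\<close>, leaving an integer
        multiple of \<open>1 / ?n\<close>.\<close>
      case True
      then have "of_nat (p ^ a k) = (of_nat (p ^ y * p ^ (a k - y)) :: rat)"
        by (simp flip: power_add)
      then have "1 / of_nat (p ^ y) * (of_nat ?m / of_nat ?n) =
          (of_int (int (p ^ (a k - y) * m')) * (1 / of_nat ?n) :: rat)"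
        unfolding m' using p(1) by (simp add: field_simps)
      then show ?thesis unfolding p_def using of_int_mult_in_G[OF n_inv] by metis
    next
      case False
      \<comment> \<open>The uncancelled part \<open>p ^ z\<close> joins the factor
        \<open>p ^ b k\<close> of \<open>?n\<close>, giving exponent \<open>z + b k\<close>.\<close>
      define z where "z = y - a k"
      have y: "y = z + a k" using False by (simp add: z_def)
      have h: "height_ge j k (z + b k)" using ab prime_power unfolding y by blast
      have "multiplicity (prime_at l) (p ^ z * ?n) = (if l = k then z else 0) + b l" for l
      proof -
        have "multiplicity (prime_at l) (p ^ z) = (if l = k then z else 0)"
          unfolding p_def by (rule multiplicity_prime_at_power)
        then show ?thesis
          using p pos prime_prime_at[of l]
          by (subst prime_elem_multiplicity_mult_distrib) (auto simp: mult_n)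
      qed
      then have "p ^ z * ?n \<in> denoms j"
        using h b pos p by (auto simp: denoms_def)
      note inv = inverse_denom_in_G[OF this]
      have "1 / of_nat (p ^ y) * (of_nat ?m / of_nat ?n) =
          (of_int (int m') * (1 / of_nat (p ^ z * ?n)) :: rat)"
        unfolding m' y using p(1) by (simp add: field_simps power_add)
      then show ?thesis unfolding p_def using of_int_mult_in_G[OF inv] by (metis p_def)
    qed
  qed
qed

lemma ex_aligned_heights:
  assumes "height_le_upto K i j" "height_le_upto K j i"
  shows "\<exists>a b. height_ge i k a \<and> height_ge j k b \<and>
    (\<forall>y. height_ge i k (y + a) \<longleftrightarrow> height_ge j k (y + b)) \<and> (K \<le> k \<longrightarrow> a = 0 \<and> b = 0)"
proof (cases "K \<le> k \<or> (\<forall>y. height_ge i k y) \<or> (\<forall>y. height_ge j k y)")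
  case True
  have ij: "height_ge i k (y + (if k < K then K else 0)) \<Longrightarrow> height_ge j k y"
    "height_ge j k (y + (if k < K then K else 0)) \<Longrightarrow> height_ge i k y" for y
    using assms unfolding height_le_upto_def by blast+
  from True have "height_ge i k y \<longleftrightarrow> height_ge j k y" for y
    using ij[of y] by (cases "K \<le> k") (auto split: if_splits)
  then show ?thesis by (intro exI[of _ 0]) simp
next
  case False
  have *: "\<exists>a. \<forall>y. height_ge l k (y + a) \<longleftrightarrow> y = 0" if "\<not> height_ge l k y" for l y
  proof -
    define c where "c = (LEAST y. \<not> height_ge l k y)"
    have c: "\<not> height_ge l k c" unfolding c_def by (rule LeastI[of _ y]) fact
    \<comment> \<open>The first excluded exponent \<open>c\<close> is positive because exponent 0 is
      always allowed; its predecessor is the height.\<close>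
    then obtain a where a: "c = Suc a" by (cases c) auto
    have "height_ge l k a" using not_less_Least[of a "\<lambda>y. \<not> height_ge l k y"] a c_def by simp
    moreover have "\<not> height_ge l k (y + a)" if "y \<noteq> 0" for y
      using c height_ge_mono[of l k "y + a" c] that a by auto
    ultimately have "height_ge l k (y + a) \<longleftrightarrow> y = 0" for y by (cases "y = 0") auto
    then show ?thesis by blast
  qed
  from False * obtain a b where ab: "\<And>y. height_ge i k (y + a) \<longleftrightarrow> y = 0"
    "\<And>y. height_ge j k (y + b) \<longleftrightarrow> y = 0" by metis
  from ab(1)[of 0] ab(2)[of 0] show ?thesis
    using False ab by (intro exI[of _ a] exI[of _ b]) simp
qed

text \<open>A rational factor \<open>m / n\<close> moves the heights of \<open>G i\<close> to those
  of \<open>G j\<close> at the finitely many exceptional primes; the inverse map is multiplication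
  by \<open>n / m\<close>.\<close>

lemma height_le_upto_imp_iso:
  assumes "height_le_upto K i j" "height_le_upto L j i"
  shows "G i \<cong> G j"
proof -
  define M where "M = max K L"
  note le = height_le_upto_mono[OF assms(1), of M] height_le_upto_mono[OF assms(2), of M]
  obtain c d where cd: "\<And>k y. height_ge i k (y + c k) \<longleftrightarrow> height_ge j k (y + d k)"
    and cd0: "\<And>k. M \<le> k \<Longrightarrow> c k = 0 \<and> d k = 0"
    and c: "\<And>k. height_ge i k (c k)" and d: "\<And>k. height_ge j k (d k)"
    using ex_aligned_heights[OF le] unfolding M_def by (metis max.cobounded1 max.cobounded2)
  define m n where "m = (\<Prod>k<M. prime_at k ^ c k)" and "n = (\<Prod>k<M. prime_at k ^ d k)"
  have pos: "m > 0" "n > 0"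
    by (auto intro!: prod_pos simp: m_def n_def prime_gt_0_nat prime_prime_at)
  have "x * (of_nat m / of_nat n) \<in> carrier (G j)" if "x \<in> carrier (G i)" for x
    unfolding m_def n_def using cd d cd0 that by (intro scale_carrier_G[of i c j d]) auto
  moreover have "x * (of_nat n / of_nat m) \<in> carrier (G i)" if "x \<in> carrier (G j)" for x
    unfolding m_def n_def using cd c cd0 that by (intro scale_carrier_G[of j d i c]) auto
  ultimately have "group_isomorphisms (G i) (G j)
      (\<lambda>x. x * (of_nat m / of_nat n)) (\<lambda>x. x * (of_nat n / of_nat m))"
    using pos by (auto simp: group_isomorphisms_def hom_def mult_G distrib_right add_divide_distrib)
  then show ?thesis using group_isomorphisms_imp_iso is_iso_def by blast
qed

lemma G_iso_iff: "G i \<cong> G j \<longleftrightarrow> (\<exists>K. height_le_upto K i j \<and> height_le_upto K j i)"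
proof
  assume iso: "G i \<cong> G j"
  have *: "\<exists>K. height_le_upto K i j" if "G i \<cong> G j" for i j
  proof -
    from that obtain h where "h \<in> iso (G i) (G j)" by (auto simp: is_iso_def)
    then show ?thesis
      by (intro embedding_imp_height_le_upto[of h]) (auto simp: iso_def bij_betw_def)
  qed
  obtain K L where "height_le_upto K i j" "height_le_upto L j i"
    using *[OF iso] *[OF group.iso_sym[OF group_G iso]] by blast
  then have "height_le_upto (max K L) i j \<and> height_le_upto (max K L) j i"
    by (auto elim: height_le_upto_mono)
  then show "\<exists>K. height_le_upto K i j \<and> height_le_upto K j i" by blast
qed (blast intro: height_le_upto_imp_iso)

section \<open>The upper bound\<close>

text \<open>The decidable matrix of \<open>height_le_upto\<close>: \<open>y'\<close> and
  \<open>s\<close> witness the premise, \<open>z\<close> and \<open>t\<close> the conclusion.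
  Exponents start at \<open>Suc y\<close> since exponent 0 holds by convention, not by enumeration
  into \<open>W\<close>.\<close>

definition height_test :: "nat \<Rightarrow> nat \<Rightarrow> nat \<Rightarrow> nat \<Rightarrow> nat \<Rightarrow> nat \<Rightarrow> nat \<Rightarrow> nat \<Rightarrow> nat \<Rightarrow> bool" where
  "height_test K i j k y y' s z t \<longleftrightarrow>
    (Suc y + (if k < K then K else 0) \<le> y' \<and> converges_in i (prod_encode (Suc k, y')) s \<longrightarrow>
     Suc y \<le> z \<and> converges_in j (prod_encode (Suc k, z)) t)"

lemma height_ge_Suc_iff:
  "height_ge i k (Suc y) \<longleftrightarrow> (\<exists>z s. Suc y \<le> z \<and> converges_in i (prod_encode (Suc k, z)) s)"
  by (auto simp: height_ge_def W_def in_re_set_iff)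

text \<open>Prenex form: the existential witnesses of the premise become universally
  quantified.\<close>

lemma height_le_upto_iff:
  "height_le_upto K i j \<longleftrightarrow> (\<forall>k y y' s. \<exists>z t. height_test K i j k y y' s z t)"
proof -
  have "height_le_upto K i j \<longleftrightarrow>
      (\<forall>k y. height_ge i k (Suc (y + (if k < K then K else 0))) \<longrightarrow> height_ge j k (Suc y))"
    unfolding height_le_upto_def by (metis add_Suc height_ge_0 not0_implies_Suc)
  also have "\<dots> \<longleftrightarrow> (\<forall>k y y' s. \<exists>z t. height_test K i j k y y' s z t)"
    unfolding height_ge_Suc_iff height_test_def by (simp only: add_Suc) blast
  finally show ?thesis .
qed

lemma decidable_height_test:
  assumes "computable K" "computable i" "computable j" "computable k" "computable y"
    "computable y'" "computable s" "computable z" "computable t"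
  shows "decidable {x. height_test (K x) (i x) (j x) (k x) (y x) (y' x) (s x) (z x) (t x)}"
  unfolding height_test_def by (intro decidable_converges_in computable_intros assms)

lemma Sigma03_G_iso: "Sigma03 (prod_encode ` {(i, j). G i \<cong> G j})"
proof -
  \<comment> \<open>\<open>a\<close> is the bound \<open>K\<close>, \<open>b\<close> codes
    \<open>\<langle>\<langle>k, y\<rangle>, \<langle>y', s\<rangle>\<rangle>\<close> for both
    directions at once, and \<open>c\<close> codes one pair of witnesses for each direction.\<close>
  define test where "test n a b c \<longleftrightarrow>
    height_test a (pfst n) (psnd n) (pfst (pfst b)) (psnd (pfst b)) (pfst (psnd b)) (psnd (psnd b))
      (pfst (pfst c)) (psnd (pfst c)) \<and>
    height_test a (psnd n) (pfst n) (pfst (pfst b)) (psnd (pfst b)) (pfst (psnd b)) (psnd (psnd b))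
      (pfst (psnd c)) (psnd (psnd c))" for n a b c
  define D where "D = {t. test (pfst t) (pfst (psnd t)) (pfst (psnd (psnd t))) (psnd (psnd (psnd t)))}"
  have "decidable D"
    unfolding D_def test_def by (intro decidable_conj decidable_height_test computable_intros)
  moreover have "n \<in> prod_encode ` {(i, j). G i \<cong> G j} \<longleftrightarrow>
      (\<exists>a. \<forall>b. \<exists>c. prod_encode (n, prod_encode (a, prod_encode (b, c))) \<in> D)" for n
  proof -
    have "(\<forall>b. \<exists>c. test n a b c) \<longleftrightarrow>
        height_le_upto a (pfst n) (psnd n) \<and> height_le_upto a (psnd n) (pfst n)" for a
    proof
      assume all: "\<forall>b. \<exists>c. test n a b c"
      have "(\<exists>z t. height_test a (pfst n) (psnd n) k y y' s z t) \<and>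
          (\<exists>z t. height_test a (psnd n) (pfst n) k y y' s z t)" for k y y' s
      proof -
        obtain c where "test n a (prod_encode (prod_encode (k, y), prod_encode (y', s))) c"
          using all by blast
        then show ?thesis unfolding test_def prod_encode_inverse fst_conv snd_conv by blast
      qed
      then show "height_le_upto a (pfst n) (psnd n) \<and> height_le_upto a (psnd n) (pfst n)"
        by (simp add: height_le_upto_iff)
    next
      assume le: "height_le_upto a (pfst n) (psnd n) \<and> height_le_upto a (psnd n) (pfst n)"
      show "\<forall>b. \<exists>c. test n a b c"
      proof
        fix b
        from le obtain z t z' t' where
          "height_test a (pfst n) (psnd n) (pfst (pfst b)) (psnd (pfst b)) (pfst (psnd b)) (psnd (psnd b)) z t"
          "height_test a (psnd n) (pfst n) (pfst (pfst b)) (psnd (pfst b)) (pfst (psnd b)) (psnd (psnd b)) z' t'"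
          unfolding height_le_upto_iff by blast
        then have "test n a b (prod_encode (prod_encode (z, t), prod_encode (z', t')))"
          by (simp add: test_def)
        then show "\<exists>c. test n a b c" ..
      qed
    qed
    then have "(\<exists>a. \<forall>b. \<exists>c. test n a b c) \<longleftrightarrow> G (pfst n) \<cong> G (psnd n)"
      by (simp add: G_iso_iff)
    moreover have "n \<in> prod_encode ` {(i, j). G i \<cong> G j} \<longleftrightarrow> G (pfst n) \<cong> G (psnd n)"
      using inj_image_mem_iff[OF inj_prod_encode[of UNIV], of "prod_decode n" "{(i, j). G i \<cong> G j}"]
      by (simp add: split_beta)
    ultimately show ?thesis by (simp add: D_def)
  qed
  ultimately show ?thesis unfolding Sigma03_def by blast
qed

lemma equiv_G_iso: "equiv UNIV {(i, j). G i \<cong> G j}"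
proof (rule equivI)
  show "refl {(i, j). G i \<cong> G j}" by (auto simp: refl_on_def)
  show "sym {(i, j). G i \<cong> G j}" by (auto simp: sym_def intro: group.iso_sym[OF group_G])
  show "trans {(i, j). G i \<cong> G j}" by (auto simp: trans_def intro: iso_trans)
qed simp

section \<open>Hardness\<close>

primrec numeral_prog :: "nat \<Rightarrow> recf" where
  "numeral_prog 0 = Zero"
| "numeral_prog (Suc n) = Cn Succ (numeral_prog n)"

lemma eval_numeral_prog: "eval (numeral_prog n) x = Some n"
  by (induction n) auto

lemma computable_goedel_numeral_prog: "computable (\<lambda>n. goedel (numeral_prog n))"
proof -
  have "goedel (numeral_prog n) = rec_nat 0 (\<lambda>_ r. 4 * prod_encode (1, r) + 5) n" for n
    by (induction n) (auto simp: goedel.simps)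
  then show ?thesis by (simp only:) (intro computable_rec_nat computable_intros)
qed

text \<open>An instance of the s-m-n theorem: the program with code \<open>f w\<close> searches for
  \<open>s\<close>, with \<open>w\<close> built in as a constant program. The test is total, so the
  search ends exactly if some \<open>s\<close> works.\<close>

lemma uniformly_re:
  assumes "decidable {t. R (pfst (pfst t)) (psnd (pfst t)) (psnd t)}"
  shows "\<exists>f. computable f \<and> (\<forall>w z. z \<in> re_set (f w) \<longleftrightarrow> (\<exists>s. R w z s))"
proof -
  have "computable (\<lambda>t. if R (pfst (pfst t)) (psnd (pfst t)) (psnd t) then 0 else 1)"
    by (intro computable_if assms computable_const)
  then obtain c where c: "eval c t = Some (if R (pfst (pfst t)) (psnd (pfst t)) (psnd t) then 0 else 1)" for t
    unfolding computable_def by blast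
  \<comment> \<open>\<open>Pr Fst Snd\<close> computes the identity, so the inner program sends
    \<open>z\<close> to \<open>\<langle>w, z\<rangle>\<close>.\<close>
  define f where "f w = goedel (Cn (Mn c) (Pr (numeral_prog w) (Pr Fst Snd)))" for w
  have "computable f"
    unfolding f_def goedel.simps
    by (intro computable_intros computable_goedel_numeral_prog)
  moreover have "z \<in> re_set (f w) \<longleftrightarrow> (\<exists>s. R w z s)" for w z
  proof -
    have "z \<in> re_set (f w) \<longleftrightarrow> minimise (eval c) (prod_encode (w, z)) \<noteq> None"
      by (auto simp: re_set_def f_def the_inv_f_f bij_is_inj[OF bij_goedel] eval_numeral_prog)
    also have "\<dots> \<longleftrightarrow> (\<exists>s. R w z s)"
      unfolding minimise_def c by auto
    finally show ?thesis .
  qed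
  ultimately show ?thesis by blast
qed

lemma decidable_in_set_decode:
  assumes "computable f" "computable g"
  shows "decidable {x. f x \<in> set_decode (g x)}"
proof -
  have "n \<in> set_decode c \<longleftrightarrow> (c div 2 ^ n) mod 2 = 1" for n c
    by (simp add: set_decode_def odd_iff_mod_2_eq_one)
  then show ?thesis by (simp only:) (intro computable_intros assms)
qed

definition set_ins :: "nat \<Rightarrow> nat \<Rightarrow> nat" where
  "set_ins u c = (if u \<in> set_decode c then c else 2 ^ u + c)"

lemma set_decode_set_ins [simp]: "set_decode (set_ins u c) = insert u (set_decode c)"
  by (auto simp: set_ins_def set_decode_plus_power_2)

lemma computable_set_ins:
  assumes "computable f" "computable g"
  shows "computable (\<lambda>x. set_ins (f x) (g x))"
  unfolding set_ins_def by (intro computable_intros decidable_in_set_decode assms)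

text \<open>
  Here \<open>e = \<langle>n, a\<rangle>\<close>, and \<open>e\<close> fires at the stages at which more instances of the \<open>\<forall>\<exists>\<close> matrix of the
  \<open>\<Sigma>\<^sup>0\<^sub>3\<close> formula become verified. The conjunct \<open>m \<le> t\<close> makes the stages for different \<open>m\<close> unbounded,
  so that infinitely many firings are the same as the truth of the \<open>\<forall>\<exists>\<close> matrix.
\<close>

definition verified :: "nat set \<Rightarrow> nat \<Rightarrow> nat \<Rightarrow> nat \<Rightarrow> bool" where
  "verified D e m t \<longleftrightarrow>
    m \<le> t \<and> (\<forall>b<m. \<exists>c<t. prod_encode (pfst e, prod_encode (psnd e, prod_encode (b, c))) \<in> D)"

definition fires :: "nat set \<Rightarrow> nat \<Rightarrow> nat \<Rightarrow> bool" where
  "fires D e t \<longleftrightarrow> (\<exists>m<Suc t. verified D e m t \<and> (t = 0 \<or> \<not> verified D e m (t - 1)))"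

lemma verified_mono: "verified D e m t \<Longrightarrow> t \<le> t' \<Longrightarrow> verified D e m t'"
  unfolding verified_def by (meson less_le_trans order_trans)

text \<open>By monotonicity in \<open>t\<close>, failure at the previous stage means failure at all
  earlier ones.\<close>

lemma first_verified_iff:
  "verified D e m t \<and> (t = 0 \<or> \<not> verified D e m (t - 1)) \<longleftrightarrow>
    (verified D e m t \<and> t = (LEAST t. verified D e m t))"
proof (intro conj_cong refl iffI)
  assume t: "verified D e m t" and "t = 0 \<or> \<not> verified D e m (t - 1)"
  then have "\<not> verified D e m t'" if "t' < t" for t'
    using verified_mono[of D e m t' "t - 1"] that by (cases t) auto
  then show "t = (LEAST t. verified D e m t)"
    using t by (intro Least_equality[symmetric]) (auto simp: not_less[symmetric] simp del: not_less)
next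
  assume "t = (LEAST t. verified D e m t)"
  then show "t = 0 \<or> \<not> verified D e m (t - 1)"
    using not_less_Least[of "t - 1" "verified D e m"] by (cases t) auto
qed

lemma fires_iff: "fires D e t \<longleftrightarrow> (\<exists>m\<le>t. verified D e m t \<and> t = (LEAST t. verified D e m t))"
  unfolding fires_def first_verified_iff less_Suc_eq_le ..

text \<open>Each \<open>m\<close> causes a firing only at its first verified stage. If some
  \<open>b\<close> has no \<open>c\<close>, only the \<open>m \<le> b\<close> are ever verified.
  Otherwise every \<open>m\<close> causes a firing, at a stage no earlier than
  \<open>m\<close>.\<close>

lemma infinite_fires_iff:
  "infinite {t. fires D e t} \<longleftrightarrow>
    (\<forall>b. \<exists>c. prod_encode (pfst e, prod_encode (psnd e, prod_encode (b, c))) \<in> D)"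
    (is "_ \<longleftrightarrow> (\<forall>b. \<exists>c. ?D b c)")
proof
  assume inf: "infinite {t. fires D e t}"
  show "\<forall>b. \<exists>c. ?D b c"
  proof (rule ccontr)
    assume "\<not> (\<forall>b. \<exists>c. ?D b c)"
    then obtain b where b: "\<And>c. \<not> ?D b c" by blast
    have "{t. fires D e t} \<subseteq> (\<lambda>m. LEAST t. verified D e m t) ` {..b}"
    proof
      fix t assume "t \<in> {t. fires D e t}"
      then obtain m where "verified D e m t" "t = (LEAST t. verified D e m t)"
        by (auto simp: fires_iff)
      moreover from this(1) b have "m \<le> b" by (auto simp: verified_def intro: leI)
      ultimately show "t \<in> (\<lambda>m. LEAST t. verified D e m t) ` {..b}" by blast
    qed
    then show False using inf finite_subset by blast
  qed
next
  assume all: "\<forall>b. \<exists>c. ?D b c"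
  have ex: "\<exists>t. verified D e m t" for m
  proof (induction m)
    case 0
    show ?case by (rule exI[of _ 0]) (simp add: verified_def)
  next
    case (Suc m)
    then obtain t where t: "verified D e m t" by blast
    obtain c where c: "?D m c" using all by blast
    define t' where "t' = Suc (max t (max c m))"
    have "verified D e m t'" by (rule verified_mono[OF t]) (simp add: t'_def)
    moreover have "m < t'" "c < t'" by (simp_all add: t'_def)
    ultimately have "verified D e (Suc m) t'"
      using c unfolding verified_def by (metis Suc_leI less_Suc_eq)
    then show ?case by blast
  qed
  have "\<exists>t\<ge>m. fires D e t" for m
  proof -
    define t where "t = (LEAST t. verified D e m t)"
    have "verified D e m t" unfolding t_def using ex by (rule LeastI_ex)
    moreover from this have "m \<le> t" by (simp add: verified_def)
    ultimately have "fires D e t"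
      unfolding fires_iff using t_def by blast
    then show ?thesis using \<open>m \<le> t\<close> by blast
  qed
  then show "infinite {t. fires D e t}"
    by (auto simp: infinite_nat_iff_unbounded_le)
qed

lemma decidable_fires:
  assumes D: "decidable D" and "computable f" "computable g"
  shows "decidable {x. fires D (f x) (g x)}"
proof -
  have verified: "decidable {x. verified D (e x) (m x) (t x)}"
    if "computable e" "computable m" "computable t" for e m t
    unfolding verified_def
    by (intro computable_intros decidable_comp[OF D] that that[THEN computable_comp])
  show ?thesis
    unfolding fires_def
    by (intro computable_intros verified assms(2,3) assms(2,3)[THEN computable_comp])
qed

text \<open>A position \<open>\<pi> = \<langle>n, \<langle>x, y\<rangle>\<rangle>\<close> is used to separate \<open>x\<close> from \<open>y\<close>; the padding \<open>n\<close> provides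
  infinitely many positions for each pair. A stage \<open>s = \<langle>\<langle>\<langle>u, w\<rangle>, a\<rangle>, t\<rangle>\<close> inspects the witness
  \<open>a\<close> for the pair \<open>(u, w)\<close>.\<close>

definition active :: "nat set \<Rightarrow> nat \<Rightarrow> nat \<Rightarrow> bool" where
  "active D \<pi> s \<longleftrightarrow> pfst s < \<pi> \<and> fires D (pfst s) (psnd s)"

definition merge :: "nat set \<Rightarrow> nat \<Rightarrow> nat \<Rightarrow> nat \<Rightarrow> nat" where
  "merge D \<pi> s c =
    (if active D \<pi> s \<and>
        (pfst (pfst (pfst s)) \<in> set_decode c \<or> psnd (pfst (pfst s)) \<in> set_decode c)
     then set_ins (pfst (pfst (pfst s))) (set_ins (psnd (pfst (pfst s))) c) else c)"

text \<open>A state pairs the base height with a code of the raised set;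
  \<open>set_ins (pfst (psnd \<pi>)) 0\<close> codes the singleton of \<open>x\<close>, as 0 codes
  the empty set.\<close>

definition advance :: "nat set \<Rightarrow> nat \<Rightarrow> nat \<Rightarrow> nat \<Rightarrow> nat" where
  "advance D \<pi> s r =
    (if psnd (psnd \<pi>) \<in> set_decode (merge D \<pi> s (psnd r))
     then prod_encode (Suc (pfst r), set_ins (pfst (psnd \<pi>)) 0)
     else prod_encode (pfst r, merge D \<pi> s (psnd r)))"

definition state :: "nat set \<Rightarrow> nat \<Rightarrow> nat \<Rightarrow> nat" where
  "state D \<pi> = rec_nat (prod_encode (0, set_ins (pfst (psnd \<pi>)) 0)) (advance D \<pi>)"

definition base :: "nat set \<Rightarrow> nat \<Rightarrow> nat \<Rightarrow> nat" where
  "base D \<pi> s = pfst (state D \<pi> s)"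

definition raised :: "nat set \<Rightarrow> nat \<Rightarrow> nat \<Rightarrow> nat set" where
  "raised D \<pi> s = set_decode (psnd (state D \<pi> s))"

definition level :: "nat set \<Rightarrow> nat \<Rightarrow> nat \<Rightarrow> nat \<Rightarrow> nat" where
  "level D \<pi> s w = (if w \<in> raised D \<pi> s then Suc (base D \<pi> s) else base D \<pi> s)"

lemma decidable_le_level:
  assumes D: "decidable D"
    and "computable f" "computable g" "computable h" "computable w"
  shows "decidable {x. f x \<le> level D (g x) (h x) (w x)}"
proof -
  note rules = decidable_fires[OF D] decidable_in_set_decode computable_set_ins computable_intros
  have merge: "computable (\<lambda>x. merge D (g x) (h x) (c x))"
    if "computable g" "computable h" "computable c" for g h c
    unfolding merge_def active_def by (intro rules that)
  have adv: "computable (\<lambda>x. advance D (g x) (h x) (c x))"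
    if "computable g" "computable h" "computable c" for g h c
    unfolding advance_def by (intro rules merge that)
  have "computable (\<lambda>x. state D (g x) (h x))"
    unfolding state_def
    by (intro computable_rec_nat adv rules assms(3,4) assms(3)[THEN computable_comp])
  then show ?thesis
    unfolding level_def raised_def base_def by (intro rules assms)
qed

section \<open>Behaviour of the levels at a fixed position\<close>

context
  fixes D :: "nat set" and \<pi> x y :: nat
  assumes pi: "x = pfst (psnd \<pi>)" "y = psnd (psnd \<pi>)"
begin

definition merged :: "nat \<Rightarrow> nat set" where
  "merged s = (let u = pfst (pfst (pfst s)); w = psnd (pfst (pfst s)) in
     if active D \<pi> s \<and> (u \<in> raised D \<pi> s \<or> w \<in> raised D \<pi> s)
     then insert u (insert w (raised D \<pi> s)) else raised D \<pi> s)"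

lemma set_decode_merge: "set_decode (merge D \<pi> s (psnd (state D \<pi> s))) = merged s"
  by (auto simp: merge_def merged_def raised_def Let_def)

lemma raised_0: "raised D \<pi> 0 = {x}" and base_0: "base D \<pi> 0 = 0"
  by (simp_all add: raised_def base_def state_def pi)

lemma raised_Suc: "raised D \<pi> (Suc s) = (if y \<in> merged s then {x} else merged s)"
  and base_Suc: "base D \<pi> (Suc s) = (if y \<in> merged s then Suc (base D \<pi> s) else base D \<pi> s)"
proof -
  have st: "state D \<pi> (Suc s) = advance D \<pi> s (state D \<pi> s)" by (simp add: state_def)
  show "raised D \<pi> (Suc s) = (if y \<in> merged s then {x} else merged s)"
    "base D \<pi> (Suc s) = (if y \<in> merged s then Suc (base D \<pi> s) else base D \<pi> s)"
    unfolding raised_def[of D \<pi> "Suc s"] base_def st advance_def set_decode_merge pi(2)[symmetric]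
    by (simp_all add: pi set_decode_merge)
qed

lemma raised_subset_merged: "raised D \<pi> s \<subseteq> merged s"
  by (auto simp: merged_def Let_def)

text \<open>A reset lowers nothing: the new base equals the old raised height.\<close>

lemma level_Suc: "level D \<pi> s w \<le> level D \<pi> (Suc s) w"
  using raised_subset_merged[of s] by (auto simp: level_def raised_Suc base_Suc)

lemma level_mono: "s \<le> s' \<Longrightarrow> level D \<pi> s w \<le> level D \<pi> s' w"
  using level_Suc by (rule lift_Suc_mono_le)

lemma x_in_raised: "x \<in> raised D \<pi> s"
  by (induction s) (use raised_subset_merged in \<open>auto simp: raised_0 raised_Suc\<close>)

text \<open>The step that would raise \<open>y\<close> resets the raised set to \<open>{x}\<close>
  instead.\<close>

lemma y_notin_raised: "x \<noteq> y \<Longrightarrow> y \<notin> raised D \<pi> s"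
  by (cases s) (auto simp: raised_0 raised_Suc)

text \<open>Without a reset, \<open>u\<close> and \<open>w\<close> end up both raised or both not.
  After a reset, the new base dominates every old level.\<close>

lemma level_merge:
  assumes "active D \<pi> s" "pfst (pfst s) = prod_encode (u, w)"
  shows "level D \<pi> s u \<le> level D \<pi> (Suc s) w" "level D \<pi> s w \<le> level D \<pi> (Suc s) u"
  using assms by (auto simp: level_def raised_Suc base_Suc merged_def Let_def)

lemma ex_level_ge:
  assumes fires: "infinite {t. fires D (prod_encode (prod_encode (u, w), a)) t}"
    and bound: "prod_encode (prod_encode (u, w), a) < \<pi>"
  shows "\<exists>s'. level D \<pi> s u \<le> level D \<pi> s' w"
proof -
  obtain t where t: "s \<le> t" "fires D (prod_encode (prod_encode (u, w), a)) t"
    using fires by (auto simp: infinite_nat_iff_unbounded_le)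
  \<comment> \<open>The stage that inspects this witness at its firing time \<open>t\<close>; its
    code is at least \<open>t\<close>, hence at least \<open>s\<close>.\<close>
  define s' where "s' = prod_encode (prod_encode (prod_encode (u, w), a), t)"
  have "active D \<pi> s'" using t(2) bound by (simp add: active_def s'_def)
  moreover have "pfst (pfst s') = prod_encode (u, w)" by (simp add: s'_def)
  ultimately have "level D \<pi> s' u \<le> level D \<pi> (Suc s') w" by (rule level_merge)
  moreover have "level D \<pi> s u \<le> level D \<pi> s' u"
    using t(1) le_prod_encode_2[of t] unfolding s'_def by (intro level_mono) (rule order_trans)
  ultimately show ?thesis using order_trans by blast
qed

text \<open>Only finitely many active stages join the class of \<open>x\<close> to its complement. A reset after the last
  of them leaves the raised set inside this class forever, so that there is no further reset and
  \<open>base\<close> is bounded.\<close>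

lemma separated:
  assumes E: "equiv UNIV E" and xy: "(x, y) \<notin> E"
    and fires: "\<And>u w a. (u, w) \<notin> E \<Longrightarrow> finite {t. fires D (prod_encode (prod_encode (u, w), a)) t}"
  shows "\<exists>s. \<forall>s'. level D \<pi> s' y < level D \<pi> s x"
proof -
  have sym: "(w, u) \<in> E" if "(u, w) \<in> E" for u w using E that by (meson equivE symD)
  have trans: "(u, z) \<in> E" if "(u, w) \<in> E" "(w, z) \<in> E" for u w z using E that by (meson equivE transD)
  have refl: "(u, u) \<in> E" for u using E by (meson UNIV_I equivE refl_onD)
  have "x \<noteq> y" using xy refl by auto
  \<comment> \<open>Active stages that could merge different classes. Only witnesses with codes
    below \<open>\<pi>\<close> count, and each of those in question fires finitely often.\<close>
  define cross where "cross = {s. active D \<pi> s \<and> (pfst (pfst (pfst s)), psnd (pfst (pfst s))) \<notin> E}"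
  have "finite cross"
  proof (rule finite_subset)
    show "cross \<subseteq> (\<Union>e\<in>{e. e < \<pi> \<and> (pfst (pfst e), psnd (pfst e)) \<notin> E}.
        (\<lambda>t. prod_encode (e, t)) ` {t. fires D e t})"
    proof
      fix s assume "s \<in> cross"
      then show "s \<in> (\<Union>e\<in>{e. e < \<pi> \<and> (pfst (pfst e), psnd (pfst e)) \<notin> E}.
        (\<lambda>t. prod_encode (e, t)) ` {t. fires D e t})"
        by (intro UN_I[of "pfst s"] image_eqI[of _ _ "psnd s"]) (auto simp: cross_def active_def)
    qed
    have "finite {t. fires D e t}" if "(pfst (pfst e), psnd (pfst e)) \<notin> E" for e
      using fires[OF that, of "psnd e"] by simp
    then show "finite (\<Union>e\<in>{e. e < \<pi> \<and> (pfst (pfst e), psnd (pfst e)) \<notin> E}.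
        (\<lambda>t. prod_encode (e, t)) ` {t. fires D e t})"
      by auto
  qed
  then obtain s0 where s0: "\<And>s. s \<in> cross \<Longrightarrow> s < s0"
    unfolding finite_nat_set_iff_bounded by blast
  have class_closed: "merged s \<subseteq> {z. (x, z) \<in> E}"
    if "raised D \<pi> s \<subseteq> {z. (x, z) \<in> E}" "s0 \<le> s" for s
  proof -
    have "s \<notin> cross" using s0[of s] that(2) by linarith
    then have "(x, pfst (pfst (pfst s))) \<in> E \<longleftrightarrow> (x, psnd (pfst (pfst s))) \<in> E"
      if "active D \<pi> s"
      using that sym trans unfolding cross_def by blast
    then show ?thesis using that(1) unfolding merged_def Let_def by auto
  qed
  have stable: "raised D \<pi> s' \<subseteq> {z. (x, z) \<in> E} \<and> base D \<pi> s' = base D \<pi> s"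
    if "raised D \<pi> s \<subseteq> {z. (x, z) \<in> E}" "s0 \<le> s" "s \<le> s'" for s s'
    using that(3)
  proof (induction s' rule: dec_induct)
    case base
    then show ?case using that(1) by simp
  next
    case (step s')
    then have "merged s' \<subseteq> {z. (x, z) \<in> E}" using class_closed that(2) by simp
    then show ?case using step xy refl by (auto simp: raised_Suc base_Suc)
  qed
  \<comment> \<open>Either a reset after \<open>s0\<close> confines the raised set to the class of
    \<open>x\<close> for good, or there is no reset after \<open>s0\<close> at all.\<close>
  have "\<exists>s1. \<forall>s'\<ge>s1. base D \<pi> s' = base D \<pi> s1"
  proof (cases "\<exists>s\<ge>s0. y \<in> merged s")
    case True
    then obtain s where s: "s0 \<le> s" "y \<in> merged s" by blast
    then have "raised D \<pi> (Suc s) \<subseteq> {z. (x, z) \<in> E}" using refl by (simp add: raised_Suc)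
    from stable[OF this] s(1) show ?thesis by (meson le_SucI)
  next
    case False
    have "base D \<pi> s' = base D \<pi> s0" if "s0 \<le> s'" for s'
      using that by (induction s' rule: dec_induct) (use False in \<open>auto simp: base_Suc\<close>)
    then show ?thesis by blast
  qed
  then obtain s1 where s1: "\<And>s'. s1 \<le> s' \<Longrightarrow> base D \<pi> s' = base D \<pi> s1" by blast
  \<comment> \<open>From \<open>s1\<close> on the base is constant, \<open>y\<close> sits at it and
    \<open>x\<close> one above; earlier stages follow by monotonicity.\<close>
  have "level D \<pi> s' y < level D \<pi> s1 x" for s'
  proof -
    have "level D \<pi> s' y \<le> level D \<pi> (max s' s1) y" by (rule level_mono) simp
    also have "\<dots> = base D \<pi> s1"
      using s1[of "max s' s1"] y_notin_raised[OF \<open>x \<noteq> y\<close>] by (simp add: level_def)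
    also have "\<dots> < level D \<pi> s1 x" using x_in_raised by (simp add: level_def)
    finally show ?thesis .
  qed
  then show ?thesis by blast
qed

end

lemma level_le_Suc: "level D \<pi> s u \<le> Suc (level D \<pi> s w)"
  by (simp add: level_def)

lemma Sigma03_equiv_reducible:
  assumes "Sigma03_equiv E"
  shows "reducible E {(i, j). G i \<cong> G j}"
proof -
  from assms have E: "equiv UNIV E" and "Sigma03 (prod_encode ` E)"
    by (simp_all add: Sigma03_equiv_def)
  then obtain D where D: "decidable D" and D_iff: "\<And>n. n \<in> prod_encode ` E \<longleftrightarrow>
      (\<exists>a. \<forall>b. \<exists>c. prod_encode (n, prod_encode (a, prod_encode (b, c))) \<in> D)"
    unfolding Sigma03_def by blast
  have E_iff: "(u, w) \<in> E \<longleftrightarrow> (\<exists>a. infinite {t. fires D (prod_encode (prod_encode (u, w), a)) t})"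
    for u w
    unfolding infinite_fires_iff using D_iff[of "prod_encode (u, w)"]
    by (simp add: inj_image_mem_iff[OF inj_prod_encode])
  \<comment> \<open>The group for \<open>w\<close> receives, at each position, all exponents up to
    the levels of \<open>w\<close>. The \<open>- 1\<close> turns the index used by
    \<open>nth_prime\<close> into a zero-based position.\<close>
  have "decidable {t. psnd (psnd (pfst t)) \<le>
      level D (pfst (psnd (pfst t)) - 1) (psnd t) (pfst (pfst t))}"
    by (intro decidable_le_level D computable_intros)
  then obtain f where f: "computable f"
    and re: "\<And>w z. z \<in> re_set (f w) \<longleftrightarrow> (\<exists>s. psnd z \<le> level D (pfst z - 1) s w)"
    using uniformly_re[where R = "\<lambda>w z s. psnd z \<le> level D (pfst z - 1) s w"] by blast
  have height: "height_ge (f w) \<pi> k \<longleftrightarrow> (\<exists>s. k \<le> level D \<pi> s w)" for w \<pi> k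
    unfolding height_ge_def W_def by (auto simp: re intro: order_trans)
  have le: "\<exists>K. height_le_upto K (f u) (f w)" if uw: "(u, w) \<in> E" for u w
  proof -
    obtain a where a: "infinite {t. fires D (prod_encode (prod_encode (u, w), a)) t}"
      using uw E_iff by blast
    \<comment> \<open>From position \<open>K\<close> on, the witness is among those inspected and
      the levels catch up with each other; below \<open>K\<close> they differ by at most 1, which
      \<open>K\<close> covers.\<close>
    define K where "K = Suc (prod_encode (prod_encode (u, w), a))"
    have "height_le_upto K (f u) (f w)"
      unfolding height_le_upto_def
    proof (intro allI impI)
      fix \<pi> k assume "height_ge (f u) \<pi> (k + (if \<pi> < K then K else 0))"
      then obtain s where s: "k + (if \<pi> < K then K else 0) \<le> level D \<pi> s u"
        unfolding height by blast
      show "height_ge (f w) \<pi> k"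
      proof (cases "\<pi> < K")
        case True
        then have "k \<le> level D \<pi> s w"
          using s level_le_Suc[of D \<pi> s u w] by (simp add: K_def)
        then show ?thesis unfolding height by blast
      next
        case False
        then have "prod_encode (prod_encode (u, w), a) < \<pi>" by (simp add: K_def)
        from ex_level_ge[OF refl refl a this, of s]
        obtain s' where "level D \<pi> s u \<le> level D \<pi> s' w" by blast
        then show ?thesis unfolding height using s False by (auto intro: order_trans)
      qed
    qed
    then show ?thesis by blast
  qed
  have "(x, y) \<in> E \<longleftrightarrow> G (f x) \<cong> G (f y)" for x y
  proof
    assume "(x, y) \<in> E"
    moreover from this E have "(y, x) \<in> E" by (meson equivE symD)
    ultimately show "G (f x) \<cong> G (f y)" using le height_le_upto_imp_iso by blast
  next
    assume iso: "G (f x) \<cong> G (f y)"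
    then obtain K where K: "height_le_upto K (f x) (f y)" unfolding G_iso_iff by blast
    \<comment> \<open>Padding by \<open>K\<close> puts this position for the pair \<open>x\<close>,
      \<open>y\<close> beyond the exceptional ones, where no discrepancy is tolerated.\<close>
    define \<pi> where "\<pi> = prod_encode (K, prod_encode (x, y))"
    have "K \<le> \<pi>" unfolding \<pi>_def by (rule le_prod_encode_1)
    show "(x, y) \<in> E"
    proof (rule ccontr)
      assume "(x, y) \<notin> E"
      have "\<exists>s. \<forall>s'. level D \<pi> s' y < level D \<pi> s x"
      proof (rule separated)
        show "x = pfst (psnd \<pi>)" "y = psnd (psnd \<pi>)" by (simp_all add: \<pi>_def)
        show "equiv UNIV E" "(x, y) \<notin> E" by fact+
        show "finite {t. fires D (prod_encode (prod_encode (u, w), a)) t}"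
          if "(u, w) \<notin> E" for u w a
          using that E_iff by blast
      qed
      then obtain s where s: "\<And>s'. level D \<pi> s' y < level D \<pi> s x" by blast
      have "height_ge (f x) \<pi> (level D \<pi> s x)" unfolding height by blast
      then have "height_ge (f y) \<pi> (level D \<pi> s x)"
        using K \<open>K \<le> \<pi>\<close> by (auto simp: height_le_upto_def)
      then show False unfolding height using s by (meson leD)
    qed
  qed
  then show ?thesis unfolding reducible_def using f by blast
qed

theorem corollary4p15:
  shows "Sigma03_equiv_complete {(i, j). G i \<cong> G j}"
  unfolding Sigma03_equiv_complete_def Sigma03_equiv_def[of "{(i, j). G i \<cong> G j}"]
  using equiv_G_iso Sigma03_G_iso Sigma03_equiv_reducible by blast

end
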